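(* Let $\lambda_0\in\mathbb{R}$ and let $g$ be any exchangeable prior distribution of $\tau_0$. Every approximate design $d$ that is universally optimal for the traditional crossover model is ${\cal E}_{g,\lambda_0}$-optimal for the proportional model.
   Context: Fix integers $p\ge2$ (periods), $t\ge2$ (treatments), $n\ge1$ (subjects) and a symmetric positive definite real $p\times p$ matrix $\Sigma$ (within-subject covariance). $1_k$ is the all-ones vector of length $k$, $J_k=1_k1_k'$, $B_k=I_k-J_k/k$, prime denotes transpose, and $\tilde B=\Sigma^{-1}-\Sigma^{-1}J_p\Sigma^{-1}/(1_p'\Sigma^{-1}1_p)$. Let ${\cal S}=\{1,\dots,t\}^p$ be the set of treatment sequences. For $s=(t_1,\dots,t_p)\in{\cal S}$, $T_s$ is the $p\times t$ matrix with $(k,i)$ entry $1$ if $t_k=i$ and $0$ otherwise; $F_s$ is the $p\times t$ matrix with zero first row and, for $k\ge2$, $(k,i)$ entry $1$ if $t_{k-1}=i$ and $0$ otherwise. An (approximate) design $d$ is a vector $P_d=(p_s)_{s\in{\cal S}}$ with $p_s\ge0$, $\sum_sp_s=1$. For $1\le i,j\le2$ put $\hat C_{sij}=B_tG_{s,i}'\tilde BG_{s,j}B_t$ with $G_{s,1}=T_s$, $G_{s,2}=F_s$, $\hat C_{dij}=n\sum_sp_s\hat C_{sij}$, and $C_{dij}=\hat C_{dij}-nG_i'\tilde BG_j$ with $G_1=\sum_sp_sT_sB_t$, $G_2=\sum_sp_sF_sB_t$. Traditional model (direct effects $\tau_i$ and separate carryover effects $\gamma_i$): the information matrix for $\tau$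 is $C_d=C_{d11}-C_{d12}C_{d22}^-C_{d21}$ ($^-$ denotes a generalized inverse). A design is universally optimal if, among all approximate designs, it maximizes $\Phi(C_d)$ for every real-valued function $\Phi$ on the nonnegative definite symmetric $t\times t$ matrices with zero row and column sums satisfying: (C.1) $\Phi$ is concave; (C.2) $\Phi(S'CS)=\Phi(C)$ for every permutation matrix $S$; (C.3) $\Phi(bC)$ is nondecreasing in the scalar $b>0$. Proportional model (carryover effects equal $\lambda$ times direct effects): Fisher's information matrix for $\tau$ at $(\tau_0,\lambda_0)$ is $C_{d,\tau_0,\lambda_0}(\tau)=C_{d11}+\lambda_0(C_{d12}+C_{d21})+\lambda_0^2C_{d22}-(C_{d12}+\lambda_0C_{d22})\tau_0(\tau_0'C_{d22}\tau_0)^{-1}\tau_0'(C_{d21}+\lambda_0C_{d22})$, the last term being $0$ if $\tau_0'C_{d22}\tau_0=0$. The prior $g$ is a probability distribution on $\{\tau_0\in\mathbb{R}^t:1_t'\tau_0=0,\ \tau_0\ne0\}$; it is exchangeable if invariant under all permutations of coordinates. ${\cal E}_{g,\lambda_0}(d)=\mathbb{E}_g[\Phi_E(C_{d,\tau_0,\lambda_0}(\tau))]$, where $\Phi_E$ is the second smallest eigenvalue (counted with multiplicity). A design is ${\cal E}_{g,\lambda_0}$-optimal if it maximizes ${\cal E}_{g,\lambda_0}(d)$ over all approximate designs. *)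

theory Defs
  imports "HOL-Probability.Probability" "HOL-Computational_Algebra.Computational_Algebra"
begin

text \<open>
  The periods are the elements of a finite linearly ordered type \<open>'p\<close> and the treatments are the
  elements of a finite type \<open>'t\<close>, so that \<open>p = CARD('p)\<close> and \<open>t = CARD('t)\<close>. A treatment sequence is a
  function \<open>'p \<Rightarrow> 't\<close>. A \<open>p \<times> t\<close> matrix has type \<open>real^'t^'p\<close>, with entry \<open>(k, i)\<close> written \<open>M $ k $ i\<close>.
\<close>


section \<open>Matrices\<close>

definition positive_definite :: "real^'n^'n \<Rightarrow> bool" where
  "positive_definite A \<longleftrightarrow> transpose A = A \<and> (\<forall>x. x \<noteq> 0 \<longrightarrow> x \<bullet> (A *v x) > 0)"

definition nonneg_definite :: "real^'n^'n \<Rightarrow> bool" where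
  "nonneg_definite A \<longleftrightarrow> transpose A = A \<and> (\<forall>x. x \<bullet> (A *v x) \<ge> 0)"

definition J_mat :: "real^'n^'n" where
  "J_mat = (\<chi> i j. 1)"

definition B_mat :: "real^'n^'n" where
  "B_mat = mat 1 - (1 / real CARD('n)) *\<^sub>R J_mat"

definition outer :: "real^'m \<Rightarrow> real^'n \<Rightarrow> real^'n^'m" where
  "outer u v = (\<chi> i j. u $ i * v $ j)"

definition perm_matrix :: "('n \<Rightarrow> 'n) \<Rightarrow> real^'n^'n" where
  "perm_matrix \<pi> = (\<chi> i j. if j = \<pi> i then 1 else 0)"

definition is_ginverse :: "real^'n^'m \<Rightarrow> real^'m^'n \<Rightarrow> bool" where
  "is_ginverse A G \<longleftrightarrow> A ** G ** A = A"

text \<open>An arbitrary choice; the information matrix below does not depend on it.\<close>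

definition ginverse :: "real^'n^'m \<Rightarrow> real^'m^'n" where
  "ginverse A = (SOME G. is_ginverse A G)"

lemma is_ginverse_ginverse: "is_ginverse A (ginverse A)"
proof -
  obtain g where g: "linear g" "\<forall>v\<in>range ((*v) A). A *v g v = v"
    using linear_exists_right_inverse_on[OF matrix_vector_mul_linear[of A] subspace_UNIV] by blast
  have "A ** matrix g ** A = A"
    unfolding matrix_eq
    using g by (simp add: matrix_vector_mul_assoc[symmetric] matrix_works)
  then show ?thesis
    unfolding ginverse_def by (metis is_ginverse_def someI)
qed

definition char_polynomial :: "real^'n^'n \<Rightarrow> real poly" where
  "char_polynomial A = det (\<chi> i j. (if i = j then [:0, 1:] else 0) - [:A $ i $ j:])"

text \<open>
  Intended for symmetric matrices of size at least 2, whose characteristic polynomial has as many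
  real roots, counted with multiplicity, as the size.
\<close>

definition second_smallest_eigenvalue :: "real^'n^'n \<Rightarrow> real" where
  "second_smallest_eigenvalue A = sorted_list_of_multiset (proots (char_polynomial A)) ! 1"


section \<open>Designs\<close>

type_synonym ('p, 't) design = "('p \<Rightarrow> 't) \<Rightarrow> real"

definition approx_design :: "('p::finite, 't::finite) design \<Rightarrow> bool" where
  "approx_design P \<longleftrightarrow> (\<forall>s. 0 \<le> P s) \<and> (\<Sum>s\<in>UNIV. P s) = 1"

definition T_mat :: "('p::finite \<Rightarrow> 't::finite) \<Rightarrow> real^'t^'p" where
  "T_mat s = (\<chi> k i. if s k = i then 1 else 0)"

text \<open>The period immediately preceding \<open>k\<close> is \<open>Max {j. j < k}\<close>.\<close>

definition F_mat :: "('p \<Rightarrow> 't) \<Rightarrow> real^'t^('p::{finite,linorder})" where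
  "F_mat s = (\<chi> k i. if {j. j < k} \<noteq> {} \<and> s (Max {j. j < k}) = i then 1 else 0)"

definition B_tilde :: "real^'p^'p \<Rightarrow> real^'p^'p" where
  "B_tilde \<Sigma> = matrix_inv \<Sigma> - 
     (1 / (1 \<bullet> (matrix_inv \<Sigma> *v 1))) *\<^sub>R (matrix_inv \<Sigma> ** J_mat ** matrix_inv \<Sigma>)"

text \<open>
  The blocks \<open>C\<^sub>d\<^sub>i\<^sub>j\<close> are obtained by taking \<open>T_mat\<close> (index 1) or \<open>F_mat\<close> (index 2) for \<open>G\<close> and \<open>H\<close>.
\<close>

definition C_hat_seq ::
  "real^'p^'p \<Rightarrow> (('p::finite \<Rightarrow> 't::finite) \<Rightarrow> real^'t^'p) \<Rightarrow> (('p \<Rightarrow> 't) \<Rightarrow> real^'t^'p) \<Rightarrow>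
    ('p \<Rightarrow> 't) \<Rightarrow> real^'t^'t" where
  "C_hat_seq \<Sigma> G H s = B_mat ** transpose (G s) ** B_tilde \<Sigma> ** H s ** B_mat"

definition C_hat ::
  "nat \<Rightarrow> real^'p^'p \<Rightarrow> (('p::finite \<Rightarrow> 't::finite) \<Rightarrow> real^'t^'p) \<Rightarrow> (('p \<Rightarrow> 't) \<Rightarrow> real^'t^'p) \<Rightarrow>
    ('p, 't) design \<Rightarrow> real^'t^'t" where
  "C_hat n \<Sigma> G H P = real n *\<^sub>R (\<Sum>s\<in>UNIV. P s *\<^sub>R C_hat_seq \<Sigma> G H s)"

definition G_mean ::
  "(('p::finite \<Rightarrow> 't::finite) \<Rightarrow> real^'t^'p) \<Rightarrow> ('p, 't) design \<Rightarrow> real^'t^'p" where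
  "G_mean G P = (\<Sum>s\<in>UNIV. P s *\<^sub>R (G s ** B_mat))"

definition C_block ::
  "nat \<Rightarrow> real^'p^'p \<Rightarrow> (('p::finite \<Rightarrow> 't::finite) \<Rightarrow> real^'t^'p) \<Rightarrow> (('p \<Rightarrow> 't) \<Rightarrow> real^'t^'p) \<Rightarrow>
    ('p, 't) design \<Rightarrow> real^'t^'t" where
  "C_block n \<Sigma> G H P = C_hat n \<Sigma> G H P -
     real n *\<^sub>R (transpose (G_mean G P) ** B_tilde \<Sigma> ** G_mean H P)"


section \<open>Traditional model\<close>

definition info_traditional ::
  "nat \<Rightarrow> real^('p::{finite,linorder})^('p::{finite,linorder}) \<Rightarrow> ('p, 't) design \<Rightarrow> real^'t^'t" where
  "info_traditional n \<Sigma> P = C_block n \<Sigma> T_mat T_mat P -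
     C_block n \<Sigma> T_mat F_mat P ** ginverse (C_block n \<Sigma> F_mat F_mat P) ** C_block n \<Sigma> F_mat T_mat P"

definition info_matrices :: "(real^'t^'t) set" where
  "info_matrices = {C. nonneg_definite C \<and>
     (\<forall>i. (\<Sum>j\<in>UNIV. C $ i $ j) = 0) \<and> (\<forall>j. (\<Sum>i\<in>UNIV. C $ i $ j) = 0)}"

definition optimality_criterion :: "(real^'t^'t \<Rightarrow> real) \<Rightarrow> bool" where
  "optimality_criterion \<Phi> \<longleftrightarrow>
     concave_on info_matrices \<Phi> \<and>
     (\<forall>C\<in>info_matrices. \<forall>\<pi>. bij \<pi> \<longrightarrow>
        \<Phi> (transpose (perm_matrix \<pi>) ** C ** perm_matrix \<pi>) = \<Phi> C) \<and>
     (\<forall>C\<in>info_matrices. \<forall>b c. 0 < b \<and> b \<le> c \<longrightarrow> \<Phi> (b *\<^sub>R C) \<le> \<Phi> (c *\<^sub>R C))"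

definition universally_optimal ::
  "nat \<Rightarrow> real^('p::{finite,linorder})^('p::{finite,linorder}) \<Rightarrow> ('p, 't::finite) design \<Rightarrow> bool" where
  "universally_optimal n \<Sigma> P \<longleftrightarrow> approx_design P \<and>
     (\<forall>\<Phi>. optimality_criterion \<Phi> \<longrightarrow>
        (\<forall>Q. approx_design Q \<longrightarrow> \<Phi> (info_traditional n \<Sigma> Q) \<le> \<Phi> (info_traditional n \<Sigma> P)))"


section \<open>Proportional model\<close>

definition info_proportional ::
  "nat \<Rightarrow> real^('p::{finite,linorder})^('p::{finite,linorder}) \<Rightarrow> real \<Rightarrow> real^'t \<Rightarrow> ('p, 't) design \<Rightarrow> real^'t^'t" where
  "info_proportional n \<Sigma> lam0 \<tau>\<^sub>0 P =
     (let C11 = C_block n \<Sigma> T_mat T_mat P; C12 = C_block n \<Sigma> T_mat F_mat P;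
          C21 = C_block n \<Sigma> F_mat T_mat P; C22 = C_block n \<Sigma> F_mat F_mat P;
          q = \<tau>\<^sub>0 \<bullet> (C22 *v \<tau>\<^sub>0)
      in C11 + lam0 *\<^sub>R (C12 + C21) + lam0\<^sup>2 *\<^sub>R C22 -
         (if q = 0 then 0
          else (1 / q) *\<^sub>R outer ((C12 + lam0 *\<^sub>R C22) *v \<tau>\<^sub>0) (\<tau>\<^sub>0 v* (C21 + lam0 *\<^sub>R C22))))"

definition is_prior :: "(real^'t) measure \<Rightarrow> bool" where
  "is_prior g \<longleftrightarrow> prob_space g \<and> sets g = sets borel \<and>
     (AE \<tau> in g. (\<Sum>i\<in>UNIV. \<tau> $ i) = 0 \<and> \<tau> \<noteq> 0)"

definition exchangeable :: "(real^'t) measure \<Rightarrow> bool" where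
  "exchangeable g \<longleftrightarrow> (\<forall>\<pi>. bij \<pi> \<longrightarrow> distr g borel (\<lambda>\<tau>. \<chi> i. \<tau> $ \<pi> i) = g)"

text \<open>
  For a prior \<open>g\<close> the integrand is bounded and Borel measurable in \<open>\<tau>\<^sub>0\<close>, so the Bochner integral is
  a genuine expectation.
\<close>

definition E_value ::
  "nat \<Rightarrow> real^('p::{finite,linorder})^('p::{finite,linorder}) \<Rightarrow> (real^'t) measure \<Rightarrow> real \<Rightarrow> ('p, 't) design \<Rightarrow> real"
  where
  "E_value n \<Sigma> g lam0 P =
     (\<integral>\<tau>\<^sub>0. second_smallest_eigenvalue (info_proportional n \<Sigma> lam0 \<tau>\<^sub>0 P) \<partial>g)"

definition E_optimal ::
  "nat \<Rightarrow> real^('p::{finite,linorder})^('p::{finite,linorder}) \<Rightarrow> (real^'t) measure \<Rightarrow> real \<Rightarrow> ('p, 't) design \<Rightarrow> bool"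
  where
  "E_optimal n \<Sigma> g lam0 P \<longleftrightarrow> approx_design P \<and>
     (\<forall>Q. approx_design Q \<longrightarrow> E_value n \<Sigma> g lam0 Q \<le> E_value n \<Sigma> g lam0 P)"

end

theory Submission
  imports Defs "HOL-Combinatorics.Transposition"
begin

text \<open>
  Let \<open>\<Phi>(C)\<close> be the minimum of \<open>v'Cv\<close> over unit contrasts \<open>v\<close>. This is a criterion covered by
  universal optimality, and it is the second smallest eigenvalue of a nonnegative definite \<open>C\<close>
  with \<open>C1 = 0\<close>. With \<open>h(v, w) = v'C\<^sub>1\<^sub>1v + 2v'C\<^sub>1\<^sub>2w + w'C\<^sub>2\<^sub>2w\<close>, the traditional information about
  \<open>v\<close> is the minimum of \<open>h(v, w)\<close> over all \<open>w\<close>, the proportional one the minimum over \<open>w\<close> in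
  \<open>\<lambda>\<^sub>0v + span \<tau>\<^sub>0\<close> only. So \<open>\<Phi>\<close> of the traditional information matrix of \<open>d\<close> is a lower bound for
  the E-value of \<open>d\<close>. Conversely, for a design \<open>Q\<close> with symmetrization \<open>R\<close>, testing with
  \<open>v = \<tau>\<^sub>0\<close> bounds \<open>\<Phi>\<close> of the proportional matrix by \<open>h(\<tau>\<^sub>0, x\<tau>\<^sub>0) / |\<tau>\<^sub>0|\<^sup>2\<close> for every \<open>x\<close>.
  Averaging over the exchangeable prior replaces \<open>Q\<close> by \<open>R\<close>, all of whose blocks are multiples of
  \<open>B\<^sub>t\<close>, and minimizing over \<open>x\<close> gives \<open>\<Phi>\<close> of the traditional information matrix of \<open>R\<close>.
\<close>

section \<open>Spectral theory of symmetric matrices\<close>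

text \<open>For small \<open>c\<close> of the sign opposite to \<open>b\<close> the linear term
  would outweigh the quadratic one. This serves as the first-order condition at a minimizer.\<close>

lemma linear_coeff_eq_0_if_quadratic_nonneg:
  fixes b q :: real
  assumes "\<And>c. 0 \<le> 2 * c * b + c\<^sup>2 * q"
  shows "b = 0"
proof (rule ccontr)
  assume "b \<noteq> 0"
  \<comment> \<open>At \<open>c = - b / r\<close> the expression equals
    \<open>b\<^sup>2 * (q - 2 * r) / r\<^sup>2\<close>, so any \<open>r > 0\<close> with
    \<open>q < 2 * r\<close> gives the contradiction.\<close>
  define r where "r = 1 + \<bar>q\<bar>"
  have r: "r > 0" "q < 2 * r" unfolding r_def by auto
  have "0 \<le> r\<^sup>2 * (2 * (- b / r) * b + (- b / r)\<^sup>2 * q)"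
    using assms[of "- b / r"] by simp
  also have "\<dots> = b\<^sup>2 * (q - 2 * r)"
    using r by (simp add: field_simps power2_eq_square)
  also have "\<dots> < 0"
    using r \<open>b \<noteq> 0\<close> by (simp add: mult_pos_neg)
  finally show False by simp
qed

text \<open>An affine function bounded below on the whole line is constant. Kernel inclusions
  between the blocks of a nonnegative form come from this.\<close>

lemma linear_coeff_eq_0_if_affine_nonneg:
  fixes a b :: real
  assumes "\<And>c. 0 \<le> a + 2 * c * b"
  shows "b = 0"
proof (rule ccontr)
  assume "b \<noteq> 0"
  then have "a + 2 * (- (a + 1) / (2 * b)) * b = - 1" by (simp add: field_simps)
  then show False using assms[of "- (a + 1) / (2 * b)"] by linarith
qed

text \<open>Induction on the dimension of the invariant subspace: a minimizer \<open>u\<close> of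
  \<open>x \<bullet> f x\<close> on the unit sphere of \<open>S\<close> is an eigenvector, and
  self-adjointness makes its orthogonal complement in \<open>S\<close> invariant. Allowing a
  subspace \<open>S\<close> makes the result applicable to the space of contrasts.\<close>

lemma self_adjoint_orthonormal_eigenbasis:
  fixes f :: "'a::euclidean_space \<Rightarrow> 'a"
  assumes "linear f" and sa: "\<And>x y. f x \<bullet> y = x \<bullet> f y"
    and "subspace S" and "f ` S \<subseteq> S"
  shows "\<exists>B. B \<subseteq> S \<and> pairwise orthogonal B \<and> (\<forall>x\<in>B. norm x = 1) \<and> span B = S \<and>
             (\<forall>x\<in>B. f x = (x \<bullet> f x) *\<^sub>R x)"
  using assms(3,4)
proof (induction "dim S" arbitrary: S rule: less_induct)
  case less
  interpret f: linear f by fact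
  show ?case
  proof (cases "S \<subseteq> {0}")
    case True
    then have "S = {0}" using less.prems subspace_0 by blast
    then show ?thesis by (intro exI[of _ "{}"]) auto
  next
    case False
    then obtain w where w: "w \<in> S" "w \<noteq> 0" by auto
    define K where "K = sphere 0 1 \<inter> S"
    have "compact K" unfolding K_def
      using closed_subspace[OF less.prems(1)] by (simp add: compact_Int_closed)
    moreover have "(1 / norm w) *\<^sub>R w \<in> K"
      unfolding K_def using w less.prems(1) by (simp add: subspace_scale)
    then have "K \<noteq> {}" by blast
    moreover have "continuous_on K (\<lambda>x. x \<bullet> f x)"
      by (rule continuous_on_inner[OF continuous_on_id
            linear_continuous_on[OF linear_conv_bounded_linear[THEN iffD1, OF \<open>linear f\<close>]]])
    ultimately obtain u where u: "u \<in> K" and umin: "\<And>x. x \<in> K \<Longrightarrow> u \<bullet> f u \<le> x \<bullet> f x"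
      using continuous_attains_inf[of K "\<lambda>x. x \<bullet> f x"] by auto
    have nu: "norm u = 1" "u \<in> S" using u unfolding K_def by auto
    define m where "m = u \<bullet> f u"
    \<comment> \<open>The homogeneous form of minimality allows \<open>u\<close> to be varied
      without renormalizing.\<close>
    have ray: "0 \<le> x \<bullet> f x - m * (x \<bullet> x)" if "x \<in> S" for x
    proof (cases "x = 0")
      case False
      then have "(1 / norm x) *\<^sub>R x \<in> K"
        unfolding K_def using that less.prems(1) by (simp add: subspace_scale)
      from umin[OF this] have "m \<le> (x \<bullet> f x) / (norm x)\<^sup>2"
        unfolding m_def by (simp add: f.scale power2_eq_square)
      then show ?thesis using False
        by (simp add: field_simps power2_norm_eq_inner)
    qed (simp add: f.zero)
    \<comment> \<open>Vary \<open>u\<close> in the direction of its own residual \<open>r\<close>.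
      The form in \<open>ray\<close> vanishes at \<open>u\<close> and its linear coefficient along
      \<open>r\<close> is twice \<open>r \<bullet> r\<close>, so the residual is zero.\<close>
    have eig: "f u = m *\<^sub>R u"
    proof -
      define r where "r = f u - m *\<^sub>R u"
      have rS: "r \<in> S" unfolding r_def using nu less.prems
        by (auto intro!: subspace_diff subspace_scale)
      have "r \<bullet> r = 0"
      proof (rule linear_coeff_eq_0_if_quadratic_nonneg)
        fix c :: real
        have uu: "u \<bullet> u = 1" using nu by (simp add: norm_eq_1)
        have ru: "u \<bullet> f r = r \<bullet> f u" by (metis sa inner_commute)
        have "r \<bullet> r = r \<bullet> (f u - m *\<^sub>R u)" unfolding r_def ..
        then have rr: "r \<bullet> r = r \<bullet> f u - m * (r \<bullet> u)" by (simp only: inner_diff_right inner_scaleR_right)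
        have "u + c *\<^sub>R r \<in> S" using nu rS less.prems(1)
          by (simp add: subspace_add subspace_scale)
        from ray[OF this]
        have "0 \<le> (u + c *\<^sub>R r) \<bullet> f (u + c *\<^sub>R r) - m * ((u + c *\<^sub>R r) \<bullet> (u + c *\<^sub>R r))" .
        also have "\<dots> = 2 * c * (r \<bullet> f u - m * (r \<bullet> u)) + c\<^sup>2 * (r \<bullet> f r - m * (r \<bullet> r))"
          unfolding f.add f.scale inner_add_left inner_add_right inner_scaleR_left inner_scaleR_right
            ru uu m_def[symmetric] inner_commute[of u r]
          by (simp add: power2_eq_square field_simps)
        also have "r \<bullet> f u - m * (r \<bullet> u) = r \<bullet> r" using rr ..
        finally show "0 \<le> 2 * c * (r \<bullet> r) + c\<^sup>2 * (r \<bullet> f r - m * (r \<bullet> r))" .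
      qed
      then show ?thesis unfolding r_def by simp
    qed
    define S' where "S' = {y \<in> S. u \<bullet> y = 0}"
    have sub': "subspace S'"
      unfolding S'_def using less.prems(1)
      by (auto simp: subspace_def inner_add_right)
    have inv': "f ` S' \<subseteq> S'"
    proof -
      have "u \<bullet> f y = 0" if "u \<bullet> y = 0" for y
        using that sa[of u y] eig by simp
      then show ?thesis unfolding S'_def using less.prems(2) by auto
    qed
    have "u \<notin> S'" unfolding S'_def using nu by (auto simp: norm_eq_1)
    then have "S' \<subset> S" unfolding S'_def using nu by blast
    then have "dim S' < dim S"
      using sub' less.prems(1) by (metis dim_psubset span_eq_iff)
    from less.hyps[OF this sub' inv'] obtain B where
      B: "B \<subseteq> S'" "pairwise orthogonal B" "\<forall>x\<in>B. norm x = 1" "span B = S'"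
         "\<forall>x\<in>B. f x = (x \<bullet> f x) *\<^sub>R x" by blast
    show ?thesis
    proof (intro exI[of _ "insert u B"] conjI)
      show sub: "insert u B \<subseteq> S" using B nu unfolding S'_def by auto
      show "pairwise orthogonal (insert u B)"
        using B unfolding S'_def
        by (auto simp: pairwise_insert orthogonal_def inner_commute)
      show "\<forall>x\<in>insert u B. norm x = 1" using B nu by auto
      show "\<forall>x\<in>insert u B. f x = (x \<bullet> f x) *\<^sub>R x" using B eig m_def by auto
      show "span (insert u B) = S"
      proof
        show "span (insert u B) \<subseteq> S" using sub less.prems(1) by (simp add: span_minimal)
        show "S \<subseteq> span (insert u B)"
        proof
          fix x assume "x \<in> S"
          define y where "y = x - (u \<bullet> x) *\<^sub>R u"
          have "y \<in> S'" unfolding S'_def y_def using \<open>x \<in> S\<close> nu less.prems(1)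
            by (auto simp: subspace_diff subspace_scale inner_diff_right norm_eq_1)
          then have "x - (u \<bullet> x) *\<^sub>R u \<in> span B" unfolding B(4) y_def .
          then show "x \<in> span (insert u B)" by (auto simp: span_insert)
        qed
      qed
    qed
  qed
qed

section \<open>Characteristic polynomial of a matrix with an orthonormal eigenbasis\<close>

lemma poly_char_polynomial: "poly (char_polynomial A) x = det (mat x - A)"
  unfolding char_polynomial_def det_def
  by (simp add: poly_sum poly_prod mat_def of_int_poly)
   (intro sum.cong prod.cong refl arg_cong2[where f="(*)"], auto)

text \<open>The orthogonal matrix \<open>P\<close> with the vectors of \<open>E\<close> as columns
  diagonalizes \<open>mat x - A\<close> for every \<open>x\<close> at once, and real polynomials
  that agree at all points are equal.\<close>

lemma char_polynomial_orthonormal_eigenbasis: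
  fixes A :: "real^'n^'n"
  assumes orth: "pairwise orthogonal E" and nrm: "\<And>x. x \<in> E \<Longrightarrow> norm x = 1"
    and card: "card E = CARD('n)"
    and eig: "\<And>x. x \<in> E \<Longrightarrow> A *v x = (x \<bullet> (A *v x)) *\<^sub>R x"
  shows "char_polynomial A = (\<Prod>x\<in>E. [:- (x \<bullet> (A *v x)), 1:])"
proof -
  have "finite E" using card by (metis card.infinite zero_less_card_finite less_irrefl)
  then obtain b where b: "bij_betw b (UNIV :: 'n set) E"
    using card by (metis finite_same_card_bij finite_class.finite_UNIV)
  define e where "e x = x \<bullet> (A *v x)" for x
  have bE: "b i \<in> E" for i using b by (auto simp: bij_betw_def)
  have binj: "b i = b j \<longleftrightarrow> i = j" for i j using b by (auto simp: bij_betw_def inj_on_def)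
  have bb: "b i \<bullet> b j = (if i = j then 1 else 0)" for i j
    using orth nrm bE binj unfolding pairwise_def orthogonal_def by (metis norm_eq_1)
  define P :: "real^'n^'n" where "P = (\<chi> i j. b j $ i)"
  have Pcol: "P *v axis j 1 = b j" for j
    unfolding matrix_vector_mult_basis by (simp add: P_def column_def vec_eq_iff)
  have "orthogonal_matrix P"
    unfolding orthogonal_matrix matrix_mult_transpose_dot_column
    by (simp add: P_def column_def bb mat_def vec_eq_iff)
  then have "transpose P ** P = mat 1" by (simp add: orthogonal_matrix_def)
  then have detP: "det (transpose P) * det P = 1"
    by (metis det_I det_mul)
  have "poly (char_polynomial A) x = poly (\<Prod>x\<in>E. [:- e x, 1:]) x" for x
  proof -
    let ?M = "transpose P ** (mat x - A) ** P"
    have matx: "mat x *v (v::real^'n) = x *\<^sub>R v" for v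
      by (simp add: mat_def matrix_vector_mult_def vec_eq_iff if_distrib if_distribR cong: if_cong)
    have "?M $ i $ j = (if i = j then x - e (b j) else 0)" for i j
    proof -
      have "?M $ i $ j = axis i 1 \<bullet> (?M *v axis j 1)"
        by (simp add: matrix_vector_mult_basis column_def inner_axis')
      also have "\<dots> = (P *v axis i 1) \<bullet> ((mat x - A) *v (P *v axis j 1))"
        by (simp add: matrix_vector_mul_assoc[symmetric] dot_lmul_matrix[symmetric] inner_commute
                 del: transpose_matrix_vector)
      also have "\<dots> = b i \<bullet> (x *\<^sub>R b j - e (b j) *\<^sub>R b j)"
        unfolding Pcol matrix_vector_mult_diff_rdistrib matx e_def using eig[OF bE] by simp
      also have "\<dots> = (if i = j then x - e (b j) else 0)"
        by (simp add: inner_diff_right bb)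
      finally show ?thesis .
    qed
    then have "det ?M = (\<Prod>i\<in>UNIV. x - e (b i))"
      by (subst det_diagonal) auto
    also have "\<dots> = (\<Prod>y\<in>E. x - e y)"
      using prod.reindex_bij_betw[OF b, of "\<lambda>y. x - e y"] by simp
    also have "det ?M = (det (transpose P) * det P) * det (mat x - A)"
      by (simp only: det_mul mult_ac)
    finally have "det (mat x - A) = (\<Prod>y\<in>E. x - e y)"
      unfolding detP by simp
    then show ?thesis by (simp add: poly_char_polynomial poly_prod)
  qed
  then show ?thesis unfolding e_def by (intro poly_eq_poly_eq_iff[THEN iffD1] ext)
qed

section \<open>The smallest information about a contrast\<close>

text \<open>The coordinate action used in \<open>exchangeable\<close>. It reverses composition:
  applying \<sigma> and then \<pi> gives
  \<open>permute_vec (\<sigma> \<circ> \<pi>)\<close>.\<close>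

definition permute_vec :: "('n \<Rightarrow> 'n) \<Rightarrow> real^'n \<Rightarrow> real^'n" where
  "permute_vec \<pi> v = (\<chi> i. v $ \<pi> i)"

lemma permute_vec_nth [simp]: "permute_vec \<pi> v $ i = v $ \<pi> i"
  by (simp add: permute_vec_def)

lemma permute_vec_scaleR: "permute_vec \<pi> (c *\<^sub>R v) = c *\<^sub>R permute_vec \<pi> v"
  by (simp add: vec_eq_iff)

lemma inner_permute_vec:
  assumes "bij \<pi>"
  shows "permute_vec \<pi> v \<bullet> permute_vec \<pi> w = v \<bullet> w"
  using sum.reindex_bij_betw[OF assms, of "\<lambda>i. v $ i * w $ i"]
  by (simp add: inner_vec_def)

lemma norm_permute_vec: "bij \<pi> \<Longrightarrow> norm (permute_vec \<pi> v) = norm v"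
  by (simp add: norm_eq_sqrt_inner inner_permute_vec)

lemma permute_vec_one [simp]: "permute_vec \<pi> 1 = 1"
  by (simp add: vec_eq_iff)

lemma one_inner_permute_vec: "bij \<pi> \<Longrightarrow> 1 \<bullet> permute_vec \<pi> v = 1 \<bullet> v"
  using inner_permute_vec[of \<pi> 1 v] by simp

lemma one_inner_vec: "1 \<bullet> (v::real^'n) = (\<Sum>i\<in>UNIV. v $ i)"
  by (simp add: inner_vec_def)

lemma perm_matrix_mult_vec: "perm_matrix \<pi> *v v = permute_vec \<pi> v"
  by (simp add: perm_matrix_def matrix_vector_mult_def vec_eq_iff if_distribR if_distrib
      cong: if_cong)

lemma inner_transpose_mult: "x \<bullet> (transpose A *v y) = (A *v x) \<bullet> (y::real^'m)"
  by (metis dot_lmul_matrix inner_commute transpose_matrix_vector)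

section \<open>Minimum of a quadratic form over unit contrasts, as an optimality criterion\<close>

definition unit_contrasts :: "(real^'n) set" where
  "unit_contrasts = {v. norm v = 1 \<and> 1 \<bullet> v = 0}"

definition min_contrast_info :: "real^'n^'n \<Rightarrow> real" where
  "min_contrast_info A = (INF v\<in>unit_contrasts. v \<bullet> (A *v v))"

text \<open>Two coordinates give the contrast \<open>x\<close>. With a single coordinate zero would
  be the only contrast and the infimum would range over the empty set.\<close>

lemma unit_contrasts_nonempty:
  assumes "CARD('n) \<ge> 2"
  shows "(unit_contrasts :: (real^'n) set) \<noteq> {}"
proof -
  obtain i j :: 'n where "i \<noteq> j"
    using assms by (metis (full_types) card_2_iff' ex_card UNIV_I)
  define x :: "real^'n" where "x = axis i 1 - axis j 1"
  have "x \<noteq> 0" using \<open>i \<noteq> j\<close> by (auto simp: x_def axis_eq_axis)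
  moreover have "1 \<bullet> x = 0" by (simp add: x_def inner_diff_right inner_axis)
  ultimately have "(1 / norm x) *\<^sub>R x \<in> unit_contrasts"
    by (simp add: unit_contrasts_def)
  then show ?thesis by blast
qed

lemma bdd_below_unit_contrasts: "bdd_below ((\<lambda>v. v \<bullet> (A *v v)) ` unit_contrasts)"
proof -
  have "unit_contrasts = sphere 0 1 \<inter> {v. 1 \<bullet> v = 0}" by (auto simp: unit_contrasts_def)
  then have "compact unit_contrasts"
    by (metis closed_hyperplane compact_Int_closed compact_sphere)
  then have "compact ((\<lambda>v. v \<bullet> (A *v v)) ` unit_contrasts)"
    by (rule compact_continuous_image[OF continuous_on_inner[OF continuous_on_id
          linear_continuous_on[OF matrix_vector_mul_bounded_linear]]])
  then show ?thesis by (simp add: compact_imp_bounded bounded_imp_bdd_below)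
qed

lemma min_contrast_info_le:
  "v \<in> unit_contrasts \<Longrightarrow> min_contrast_info A \<le> v \<bullet> (A *v v)"
  unfolding min_contrast_info_def by (rule cINF_lower[OF bdd_below_unit_contrasts])

lemma min_contrast_info_ge:
  fixes A :: "real^'n^'n"
  assumes "CARD('n) \<ge> 2" and "\<And>v. v \<in> unit_contrasts \<Longrightarrow> m \<le> v \<bullet> (A *v v)"
  shows "m \<le> min_contrast_info A"
  unfolding min_contrast_info_def
  using unit_contrasts_nonempty[OF assms(1)] assms(2) by (rule cINF_greatest)

text \<open>The homogeneous form of the bound, so that \<tau> can be inserted without being
  normalized.\<close>

lemma min_contrast_info_mult_le:
  assumes "1 \<bullet> v = 0"
  shows "min_contrast_info A * (v \<bullet> v) \<le> v \<bullet> (A *v v)"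
proof (cases "v = 0")
  case False
  then have "(1 / norm v) *\<^sub>R v \<in> unit_contrasts"
    using assms by (simp add: unit_contrasts_def)
  from min_contrast_info_le[OF this, of A] False show ?thesis
    by (simp add: matrix_vector_mult_scaleR field_simps power2_norm_eq_inner[symmetric]
        power2_eq_square)
qed simp

text \<open>An infimum of functions linear in the matrix is concave. \<open>S\<close> is left open:
  \<open>info_matrices\<close> is the domain for the optimality criterion, \<open>UNIV\<close> the
  one for continuity.\<close>

lemma concave_on_min_contrast_info:
  assumes "CARD('n) \<ge> 2" and "convex S"
  shows "concave_on S (min_contrast_info :: real^'n^'n \<Rightarrow> real)"
proof (subst concave_on_iff, intro conjI ballI allI impI)
  show "convex S" by fact
next
  fix A B :: "real^'n^'n" and a b :: real
  assume ab: "0 \<le> a" "0 \<le> b" "a + b = 1"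
  show "a * min_contrast_info A + b * min_contrast_info B
      \<le> min_contrast_info (a *\<^sub>R A + b *\<^sub>R B)"
  proof (rule min_contrast_info_ge[OF assms(1)])
    fix v :: "real^'n" assume v: "v \<in> unit_contrasts"
    have "a * min_contrast_info A + b * min_contrast_info B
        \<le> a * (v \<bullet> (A *v v)) + b * (v \<bullet> (B *v v))"
      using ab v by (intro add_mono mult_left_mono min_contrast_info_le) auto
    then show "a * min_contrast_info A + b * min_contrast_info B
        \<le> v \<bullet> ((a *\<^sub>R A + b *\<^sub>R B) *v v)"
      by (simp add: matrix_vector_mult_add_rdistrib inner_add_right
          scaleR_matrix_vector_assoc[symmetric])
  qed
qed

text \<open>A real-valued concave function on an open set in finite dimension is continuous. This
  supplies the Borel measurability of the integrand of the E-value.\<close>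

lemma continuous_on_min_contrast_info:
  assumes "CARD('n) \<ge> 2"
  shows "continuous_on UNIV (min_contrast_info :: real^'n^'n \<Rightarrow> real)"
proof -
  have "continuous_on UNIV (\<lambda>A :: real^'n^'n. - min_contrast_info A)"
    using concave_on_min_contrast_info[OF assms, of UNIV]
    by (intro convex_on_continuous) (simp_all add: concave_on_def)
  from continuous_on_minus[OF this] show ?thesis by simp
qed

lemma permute_vec_unit_contrasts:
  assumes "bij \<pi>"
  shows "permute_vec \<pi> ` unit_contrasts = unit_contrasts"
proof -
  have *: "permute_vec \<sigma> v \<in> unit_contrasts" if "bij \<sigma>" "v \<in> unit_contrasts" for \<sigma> v
    using that by (simp add: unit_contrasts_def norm_permute_vec one_inner_permute_vec)
  have "permute_vec \<pi> (permute_vec (inv \<pi>) v) = v" for v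
    using assms by (simp add: vec_eq_iff bij_is_inj)
  then show ?thesis
    using *[OF assms] *[OF bij_imp_bij_inv[OF assms]] by (auto simp: image_iff) metis
qed

lemma convex_info_matrices: "convex info_matrices"
proof (rule convexI)
  fix A B :: "real^'n^'n" and a b :: real
  assume "A \<in> info_matrices" "B \<in> info_matrices" "0 \<le> a" "0 \<le> b"
  then show "a *\<^sub>R A + b *\<^sub>R B \<in> info_matrices"
    by (simp add: info_matrices_def nonneg_definite_def transpose_def vec_eq_iff
        sum.distrib sum_distrib_left[symmetric] matrix_vector_mult_add_rdistrib inner_add_right
        scaleR_matrix_vector_assoc[symmetric])
qed

text \<open>Concave as an infimum of linear functions, invariant because permutations map the unit
  contrasts onto themselves, and monotone in the scalar because the forms in
  \<open>info_matrices\<close> are nonnegative.\<close>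

lemma optimality_criterion_min_contrast_info:
  assumes "CARD('n) \<ge> 2"
  shows "optimality_criterion (min_contrast_info :: real^'n^'n \<Rightarrow> real)"
  unfolding optimality_criterion_def
proof (intro conjI ballI allI impI)
  show "concave_on info_matrices (min_contrast_info :: real^'n^'n \<Rightarrow> real)"
    by (rule concave_on_min_contrast_info[OF assms convex_info_matrices])
next
  fix C :: "real^'n^'n" and \<pi> :: "'n \<Rightarrow> 'n"
  assume "bij \<pi>"
  have "v \<bullet> ((transpose (perm_matrix \<pi>) ** C ** perm_matrix \<pi>) *v v)
      = permute_vec \<pi> v \<bullet> (C *v permute_vec \<pi> v)" for v
    by (simp only: matrix_vector_mul_assoc[symmetric] inner_transpose_mult perm_matrix_mult_vec)
  then have "min_contrast_info (transpose (perm_matrix \<pi>) ** C ** perm_matrix \<pi>)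
      = (INF v\<in>permute_vec \<pi> ` unit_contrasts. v \<bullet> (C *v v))"
    unfolding min_contrast_info_def by (simp add: image_image)
  then show "min_contrast_info (transpose (perm_matrix \<pi>) ** C ** perm_matrix \<pi>)
      = min_contrast_info C"
    by (simp add: permute_vec_unit_contrasts[OF \<open>bij \<pi>\<close>] min_contrast_info_def)
next
  fix C :: "real^'n^'n" and b c :: real
  assume C: "C \<in> info_matrices" and bc: "0 < b \<and> b \<le> c"
  show "min_contrast_info (b *\<^sub>R C) \<le> min_contrast_info (c *\<^sub>R C)"
  proof (rule min_contrast_info_ge[OF assms])
    fix v :: "real^'n" assume "v \<in> unit_contrasts"
    then have "min_contrast_info (b *\<^sub>R C) \<le> v \<bullet> ((b *\<^sub>R C) *v v)"
      by (rule min_contrast_info_le)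
    also have "\<dots> \<le> v \<bullet> ((c *\<^sub>R C) *v v)"
      using C bc
      by (simp add: info_matrices_def nonneg_definite_def scaleR_matrix_vector_assoc[symmetric]
          mult_right_mono)
    finally show "min_contrast_info (b *\<^sub>R C) \<le> v \<bullet> ((c *\<^sub>R C) *v v)" .
  qed
qed

section \<open>The second smallest eigenvalue as a minimum over unit contrasts\<close>

lemma symmetric_inner_mult:
  "transpose A = A \<Longrightarrow> (A *v x) \<bullet> y = x \<bullet> ((A::real^'n^'n) *v y)"
  by (metis inner_transpose_mult)

lemma sum_singleton_mset: "finite B \<Longrightarrow> (\<Sum>x\<in>B. {# e x #}) = image_mset e (mset_set B)"
  by (induction B rule: finite_induct) simp_all

text \<open>The normalized vector \<open>u\<close> of ones is an eigenvector for 0, which is the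
  least eigenvalue of a nonnegative definite matrix. The other eigenvectors can be chosen as
  contrasts, and the least of their eigenvalues is the minimum of the form over unit
  contrasts.\<close>

lemma second_smallest_eigenvalue_eq_min_contrast_info:
  fixes A :: "real^'n^'n"
  assumes two: "CARD('n) \<ge> 2" and nnd: "nonneg_definite A" and ker: "A *v 1 = 0"
  shows "second_smallest_eigenvalue A = min_contrast_info A"
proof -
  define S where "S = {v :: real^'n. 1 \<bullet> v = 0}"
  have sym: "(A *v x) \<bullet> y = x \<bullet> (A *v y)" for x y
    using nnd by (simp add: nonneg_definite_def symmetric_inner_mult)
  have "subspace S" unfolding S_def by (rule subspace_hyperplane)
  moreover have "(*v) A ` S \<subseteq> S"
    using sym[of 1] ker by (auto simp: S_def)
  ultimately obtain B where "B \<subseteq> S \<and> pairwise orthogonal B \<and> (\<forall>x\<in>B. norm x = 1) \<and> span B = S \<and>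
      (\<forall>x\<in>B. A *v x = (x \<bullet> (A *v x)) *\<^sub>R x)"
    using self_adjoint_orthonormal_eigenbasis[OF matrix_vector_mul_linear[of A] sym] by meson
  then have B: "B \<subseteq> S" "pairwise orthogonal B" "\<And>x. x \<in> B \<Longrightarrow> norm x = 1" "span B = S"
    and eigB: "\<And>x. x \<in> B \<Longrightarrow> A *v x = (x \<bullet> (A *v x)) *\<^sub>R x" by blast+
  define u :: "real^'n" where "u = (1 / norm (1::real^'n)) *\<^sub>R 1"
  have "(1::real^'n) \<noteq> 0" by (simp add: vec_eq_iff)
  then have u: "norm u = 1" "A *v u = 0" "\<And>v. v \<in> S \<Longrightarrow> u \<bullet> v = 0"
    using ker by (auto simp: u_def S_def matrix_vector_mult_scaleR)
  then have "u \<notin> S" by (metis inner_eq_zero_iff norm_zero zero_neq_one)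
  define E where "E = insert u B"
  have uB: "u \<notin> B" using \<open>u \<notin> S\<close> B by blast
  have orth: "pairwise orthogonal E"
    using B u unfolding E_def by (auto simp: pairwise_insert orthogonal_def inner_commute)
  have nrm: "\<And>x. x \<in> E \<Longrightarrow> norm x = 1" using u B by (auto simp: E_def)
  then have "0 \<notin> E" by (metis norm_zero zero_neq_one)
  then have "independent E" using orth by (intro pairwise_orthogonal_independent)
  then have finE: "finite E" by (rule independent_imp_finite)
  have "span E = UNIV"
  proof -
    have "x \<in> span E" for x
    proof -
      have "x - (1 \<bullet> x / (1 \<bullet> (1::real^'n))) *\<^sub>R 1 \<in> S"
        using \<open>(1::real^'n) \<noteq> 0\<close> by (simp add: S_def inner_diff_right)
      then have "x - ((1 \<bullet> x / (1 \<bullet> (1::real^'n))) * norm (1::real^'n)) *\<^sub>R u \<in> span B"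
        using B \<open>(1::real^'n) \<noteq> 0\<close> by (simp add: u_def)
      then show ?thesis unfolding E_def span_insert by blast
    qed
    then show ?thesis by blast
  qed
  then have card: "card E = CARD('n)"
    using \<open>independent E\<close> dim_eq_card[of E UNIV] by (simp add: dim_UNIV)
  have eigE: "A *v x = (x \<bullet> (A *v x)) *\<^sub>R x" if "x \<in> E" for x
    using that eigB u by (auto simp: E_def)
  define e where "e x = x \<bullet> (A *v x)" for x
  have finB: "finite B" using finE by (simp add: E_def)
  have enn: "e x \<ge> 0" for x using nnd by (simp add: e_def nonneg_definite_def)
  define M where "M = image_mset e (mset_set B)"
  have "char_polynomial A = (\<Prod>x\<in>E. [:- e x, 1:])"
    unfolding e_def using orth nrm card eigE by (rule char_polynomial_orthonormal_eigenbasis)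
  then have "proots (char_polynomial A) = (\<Sum>x\<in>E. {# e x #})"
    by (simp add: proots_prod)
  also have "\<dots> = add_mset 0 M"
    unfolding E_def using finB uB u
    by (simp add: M_def e_def[of u] sum_singleton_mset)
  finally have roots: "proots (char_polynomial A) = add_mset 0 M" .
  have "B \<noteq> {}" using card two by (auto simp: E_def)
  then have Mne: "M \<noteq> {#}" using finB by (simp add: M_def mset_set_empty_iff)
  let ?l = "sorted_list_of_multiset M"
  have lne: "?l \<noteq> []" using Mne by (metis mset_sorted_list_of_multiset mset.simps(1))
  have setl: "set ?l = e ` B" using finB by (simp add: M_def)
  \<comment> \<open>The eigenvalue of \<open>u\<close> goes to the front since no element of
    \<open>M\<close> is negative. Index 1 is then the least element of \<open>M\<close>, also when 0
    is a multiple eigenvalue.\<close>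
  have "sorted_list_of_multiset (add_mset 0 M) = 0 # ?l"
    using enn setl by (simp add: sorted_list_of_multiset_insert insort_is_Cons)
  then have "second_smallest_eigenvalue A = hd ?l"
    unfolding second_smallest_eigenvalue_def roots using lne by (simp add: hd_conv_nth)
  also have "\<dots> = Min (e ` B)"
  proof -
    obtain y ys where l: "?l = y # ys" using lne by (cases ?l) auto
    have "sorted (y # ys)" using sorted_sorted_list_of_multiset[of M] l by simp
    then have "Min (set ?l) = y" unfolding l by (intro Min_eqI) auto
    then show ?thesis using l setl by simp
  qed
  also have "\<dots> = min_contrast_info A"
  proof (rule antisym)
    show "Min (e ` B) \<le> min_contrast_info A"
    proof (rule min_contrast_info_ge[OF two])
      fix v :: "real^'n" assume v: "v \<in> unit_contrasts"
      then have "v \<in> span B" using B by (simp add: S_def unit_contrasts_def)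
      then obtain c where c: "v = (\<Sum>x\<in>B. c x *\<^sub>R x)"
        using finB by (auto simp: span_finite)
      have bb: "x \<bullet> y = (if x = y then 1 else 0)" if "x \<in> B" "y \<in> B" for x y
        using that B unfolding pairwise_def orthogonal_def by (metis norm_eq_1)
      have vx: "x \<bullet> v = c x" if "x \<in> B" for x
        unfolding c using finB that by (simp add: inner_sum_right bb if_distrib cong: if_cong)
      have Av: "A *v v = (\<Sum>x\<in>B. (c x * e x) *\<^sub>R x)"
      proof -
        have "A *v v = (\<Sum>x\<in>B. c x *\<^sub>R (A *v x))"
          unfolding c by (simp add: linear_sum[OF matrix_vector_mul_linear] matrix_vector_mult_scaleR)
        also have "\<dots> = (\<Sum>x\<in>B. (c x * e x) *\<^sub>R x)"
          unfolding e_def by (intro sum.cong refl) (metis eigB scaleR_scaleR)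
        finally show ?thesis .
      qed
      \<comment> \<open>The squared coefficients of \<open>v\<close> are weights with sum 1, so
        \<open>v \<bullet> (A *v v)\<close> is a weighted mean of the eigenvalues belonging to
        \<open>B\<close>.\<close>
      have "1 = v \<bullet> v" using v by (simp add: unit_contrasts_def norm_eq_1)
      also have "\<dots> = (\<Sum>x\<in>B. (c x)\<^sup>2)"
        by (subst c) (simp add: inner_sum_left vx power2_eq_square)
      finally have one: "(\<Sum>x\<in>B. (c x)\<^sup>2) = 1" by simp
      have "Min (e ` B) = (\<Sum>x\<in>B. (c x)\<^sup>2 * Min (e ` B))"
        by (simp add: sum_distrib_right[symmetric] one)
      also have "\<dots> \<le> (\<Sum>x\<in>B. (c x)\<^sup>2 * e x)"
        using finB by (intro sum_mono mult_left_mono) auto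
      also have "\<dots> = v \<bullet> (A *v v)"
        unfolding Av by (simp add: inner_sum_right inner_commute[of v] vx power2_eq_square
            mult.commute mult.left_commute)
      finally show "Min (e ` B) \<le> v \<bullet> (A *v v)" .
    qed
  next
    have "min_contrast_info A \<le> e x" if "x \<in> B" for x
      unfolding e_def using that B by (intro min_contrast_info_le) (auto simp: unit_contrasts_def S_def)
    then show "min_contrast_info A \<le> Min (e ` B)"
      using finB \<open>B \<noteq> {}\<close> by simp
  qed
  finally show ?thesis .
qed

section \<open>Information as a quadratic form\<close>

lemma outer_mult_vec: "outer u v *v x = (v \<bullet> x) *\<^sub>R u"
  by (simp add: outer_def matrix_vector_mult_def vec_eq_iff inner_vec_def sum_distrib_left
      sum_distrib_right mult_ac)

lemma J_mat_mult_vec: "J_mat *v x = (1 \<bullet> x) *\<^sub>R 1"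
  by (simp add: J_mat_def matrix_vector_mult_def vec_eq_iff inner_vec_def)

lemma B_mat_mult_vec: "B_mat *v (x :: real^'n) = x - (1 \<bullet> x / real CARD('n)) *\<^sub>R 1"
  by (simp add: B_mat_def matrix_vector_mult_diff_rdistrib scaleR_matrix_vector_assoc[symmetric]
      J_mat_mult_vec)

lemma transpose_B_mat: "transpose B_mat = B_mat"
  by (simp add: B_mat_def J_mat_def transpose_def vec_eq_iff mat_def)

lemma B_mat_mult_one: "B_mat *v 1 = 0"
  by (simp add: B_mat_mult_vec inner_vec_def)

lemma one_inner_B_mat: "1 \<bullet> (B_mat *v v) = 0"
  by (simp add: B_mat_mult_vec inner_diff_right) (simp add: inner_vec_def)

lemma B_mat_mult_contrast: "1 \<bullet> v = 0 \<Longrightarrow> B_mat *v v = v"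
  by (simp add: B_mat_mult_vec)

lemma matrix_eqI_inner:
  fixes A B :: "real^'n^'m"
  assumes "\<And>v w. v \<bullet> (A *v w) = v \<bullet> (B *v w)"
  shows "A = B"
  unfolding matrix_eq using assms by (metis vector_eq_ldot)

section \<open>Definiteness of the within-subject weight matrix\<close>

lemma positive_definite_matrix_inv:
  fixes A :: "real^'n^'n"
  assumes "positive_definite A"
  shows "positive_definite (matrix_inv A)"
proof -
  let ?S = "matrix_inv A"
  have sym: "transpose A = A" and pos: "\<And>x. x \<noteq> 0 \<Longrightarrow> x \<bullet> (A *v x) > 0"
    using assms by (auto simp: positive_definite_def)
  have "\<forall>x. A *v x = 0 \<longrightarrow> x = 0" using pos by (metis inner_zero_right less_irrefl)
  then have "invertible A"
    using matrix_left_invertible_ker invertible_left_inverse by blast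
  then have inv: "A ** ?S = mat 1" "?S ** A = mat 1"
    unfolding invertible_def matrix_inv_def by (rule someI2_ex, simp)+
  have AS: "A *v (?S *v x) = x" for x
    using inv by (simp add: matrix_vector_mul_assoc)
  have "v \<bullet> (?S *v w) = v \<bullet> (transpose ?S *v w)" for v w
    by (metis AS inner_transpose_mult symmetric_inner_mult[OF sym])
  then have "?S = transpose ?S" by (rule matrix_eqI_inner)
  moreover have "x \<bullet> (?S *v x) > 0" if "x \<noteq> 0" for x
    by (metis AS matrix_vector_mult_0_right pos symmetric_inner_mult[OF sym] that)
  ultimately show ?thesis by (simp add: positive_definite_def)
qed

text \<open>With \<open>S\<close> the inverse of \<Sigma>,
  \<open>x \<bullet> (B_tilde \<Sigma> *v x)\<close> is the value of the \<open>S\<close>-form at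
  \<open>x - a *\<^sub>R 1\<close> for the minimizing \<open>a\<close>: a weighted least-squares
  residual after removal of a constant subject effect.\<close>

lemma nonneg_definite_B_tilde:
  assumes "positive_definite \<Sigma>"
  shows "nonneg_definite (B_tilde \<Sigma>)"
proof -
  define S where "S = matrix_inv \<Sigma>"
  define c where "c = 1 \<bullet> (S *v 1)"
  have pd: "positive_definite S"
    unfolding S_def by (rule positive_definite_matrix_inv[OF assms])
  have sym: "(S *v v) \<bullet> w = v \<bullet> (S *v w)" for v w
    using pd by (simp add: positive_definite_def symmetric_inner_mult)
  have nn: "x \<bullet> (S *v x) \<ge> 0" for x
    using pd unfolding positive_definite_def by (cases "x = 0") (auto intro: less_imp_le)
  have "c > 0" using pd unfolding c_def positive_definite_def by (simp add: vec_eq_iff)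
  have form: "v \<bullet> (B_tilde \<Sigma> *v w) = v \<bullet> (S *v w) - (1 \<bullet> (S *v v)) * (1 \<bullet> (S *v w)) / c" for v w
  proof -
    have "B_tilde \<Sigma> *v w = S *v w - ((1 \<bullet> (S *v w)) / c) *\<^sub>R (S *v 1)"
      unfolding B_tilde_def S_def[symmetric] c_def[symmetric]
      by (simp add: matrix_vector_mult_diff_rdistrib scaleR_matrix_vector_assoc[symmetric]
          matrix_vector_mul_assoc[symmetric] J_mat_mult_vec matrix_vector_mult_scaleR)
    moreover have "v \<bullet> (S *v 1) = 1 \<bullet> (S *v v)" by (metis sym inner_commute)
    ultimately show ?thesis by (simp add: inner_diff_right)
  qed
  have "v \<bullet> (B_tilde \<Sigma> *v w) = v \<bullet> (transpose (B_tilde \<Sigma>) *v w)" for v w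
  proof -
    have "v \<bullet> (S *v w) = w \<bullet> (S *v v)" by (metis sym inner_commute)
    then have "v \<bullet> (B_tilde \<Sigma> *v w) = w \<bullet> (B_tilde \<Sigma> *v v)" unfolding form by simp
    then show ?thesis unfolding inner_transpose_mult by (simp add: inner_commute)
  qed
  then have "B_tilde \<Sigma> = transpose (B_tilde \<Sigma>)" by (rule matrix_eqI_inner)
  moreover have "x \<bullet> (B_tilde \<Sigma> *v x) \<ge> 0" for x
  proof -
    define a where "a = (1 \<bullet> (S *v x)) / c"
    have x1: "x \<bullet> (S *v 1) = 1 \<bullet> (S *v x)" by (metis sym inner_commute)
    have "0 \<le> (x - a *\<^sub>R 1) \<bullet> (S *v (x - a *\<^sub>R 1))" by (rule nn)
    also have "\<dots> = x \<bullet> (S *v x) - 2 * a * (1 \<bullet> (S *v x)) + a\<^sup>2 * c"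
      by (simp add: matrix_vector_mult_diff_distrib matrix_vector_mult_scaleR inner_diff_left
          inner_diff_right x1 c_def[symmetric] power2_eq_square algebra_simps)
    also have "\<dots> = x \<bullet> (B_tilde \<Sigma> *v x)"
      unfolding form a_def using \<open>c > 0\<close> by (simp add: field_simps power2_eq_square)
    finally show ?thesis .
  qed
  ultimately show ?thesis by (simp add: nonneg_definite_def)
qed

lemma B_tilde_inner_commute:
  assumes "positive_definite \<Sigma>"
  shows "x \<bullet> (B_tilde \<Sigma> *v y) = y \<bullet> (B_tilde \<Sigma> *v x)"
proof -
  have "transpose (B_tilde \<Sigma>) = B_tilde \<Sigma>"
    using nonneg_definite_B_tilde[OF assms] by (simp add: nonneg_definite_def)
  from symmetric_inner_mult[OF this, of y x] show ?thesis by (simp only: inner_commute)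
qed

lemma matrix_vector_mult_sum_left: "(\<Sum>i\<in>I. A i) *v x = (\<Sum>i\<in>I. A i *v (x::real^'n))"
  by (induction I rule: infinite_finite_induct) (simp_all add: matrix_vector_mult_add_rdistrib)

section \<open>The blocks as bilinear forms\<close>

lemma C_hat_inner:
  "v \<bullet> (C_hat n \<Sigma> G H P *v w) =
     n * (\<Sum>s\<in>UNIV. P s * ((G s *v (B_mat *v v)) \<bullet> (B_tilde \<Sigma> *v (H s *v (B_mat *v w)))))"
proof -
  have "v \<bullet> (C_hat_seq \<Sigma> G H s *v w) =
      (G s *v (B_mat *v v)) \<bullet> (B_tilde \<Sigma> *v (H s *v (B_mat *v w)))" for s
  proof -
    have "C_hat_seq \<Sigma> G H s =
        transpose B_mat ** transpose (G s) ** B_tilde \<Sigma> ** H s ** B_mat"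
      by (simp add: C_hat_seq_def transpose_B_mat)
    then show ?thesis
      by (simp only: matrix_vector_mul_assoc[symmetric] inner_transpose_mult)
  qed
  then show ?thesis
    by (simp add: C_hat_def matrix_vector_mult_sum_left scaleR_matrix_vector_assoc[symmetric]
        inner_sum_right)
qed

lemma G_mean_mult_vec: "G_mean G P *v v = (\<Sum>s\<in>UNIV. P s *\<^sub>R (G s *v (B_mat *v v)))"
  by (simp add: G_mean_def matrix_vector_mult_sum_left scaleR_matrix_vector_assoc[symmetric]
      matrix_vector_mul_assoc)

lemma C_block_inner:
  "v \<bullet> (C_block n \<Sigma> G H P *v w) =
     v \<bullet> (C_hat n \<Sigma> G H P *v w) - n * ((G_mean G P *v v) \<bullet> (B_tilde \<Sigma> *v (G_mean H P *v w)))"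
  by (simp only: C_block_def matrix_vector_mult_diff_rdistrib scaleR_matrix_vector_assoc[symmetric]
      matrix_vector_mul_assoc[symmetric] inner_diff_right inner_scaleR_right inner_transpose_mult)

lemma C_hat_inner_commute:
  assumes "positive_definite \<Sigma>"
  shows "v \<bullet> (C_hat n \<Sigma> G H P *v w) = w \<bullet> (C_hat n \<Sigma> H G P *v v)"
  unfolding C_hat_inner
  by (intro arg_cong2[where f = "(*)"] sum.cong refl B_tilde_inner_commute[OF assms])

lemma transpose_C_block:
  assumes "positive_definite \<Sigma>"
  shows "transpose (C_block n \<Sigma> G H P) = C_block n \<Sigma> H G P"
proof (rule matrix_eqI_inner)
  fix v w
  show "v \<bullet> (transpose (C_block n \<Sigma> G H P) *v w) = v \<bullet> (C_block n \<Sigma> H G P *v w)"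
    unfolding inner_transpose_mult inner_commute[of "C_block n \<Sigma> G H P *v v" w] C_block_inner
      C_hat_inner_commute[OF assms, of v n H G P w]
      B_tilde_inner_commute[OF assms, of "G_mean H P *v v"] ..
qed

lemma C_block_mult_one: "C_block n \<Sigma> G H P *v 1 = 0"
proof -
  have "v \<bullet> (C_block n \<Sigma> G H P *v 1) = v \<bullet> 0" for v
    by (simp add: C_block_inner C_hat_inner G_mean_mult_vec B_mat_mult_one)
  then show ?thesis by (metis vector_eq_ldot)
qed

text \<open>
  The quadratic form \<open>h\<close> from the introduction is \<open>joint_form\<close>; the variant with the hat omits the
  correction by the means \<open>G\<^sub>1\<close> and \<open>G\<^sub>2\<close>, which vanishes for symmetrized designs.
\<close>

definition joint_form_hat ::
  "nat \<Rightarrow> real^('p::{finite,linorder})^('p::{finite,linorder}) \<Rightarrow> ('p, 't::finite) design \<Rightarrow> real^'t \<Rightarrow> real^'t \<Rightarrow> real" where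
  "joint_form_hat n \<Sigma> P v w = v \<bullet> (C_hat n \<Sigma> T_mat T_mat P *v v) +
     2 * (v \<bullet> (C_hat n \<Sigma> T_mat F_mat P *v w)) + w \<bullet> (C_hat n \<Sigma> F_mat F_mat P *v w)"

definition joint_form ::
  "nat \<Rightarrow> real^('p::{finite,linorder})^('p::{finite,linorder}) \<Rightarrow> ('p, 't::finite) design \<Rightarrow> real^'t \<Rightarrow> real^'t \<Rightarrow> real" where
  "joint_form n \<Sigma> P v w = v \<bullet> (C_block n \<Sigma> T_mat T_mat P *v v) +
     2 * (v \<bullet> (C_block n \<Sigma> T_mat F_mat P *v w)) + w \<bullet> (C_block n \<Sigma> F_mat F_mat P *v w)"

text \<open>The contribution of treatments to the expected observations under the sequence
  \<open>s\<close>, for centred direct effects \<open>v\<close> and centred carryover effects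
  \<open>w\<close>.\<close>

definition joint_response :: "('p::{finite,linorder} \<Rightarrow> 't::finite) \<Rightarrow> real^'t \<Rightarrow> real^'t \<Rightarrow> real^('p::{finite,linorder})" where
  "joint_response s v w = T_mat s *v (B_mat *v v) + F_mat s *v (B_mat *v w)"

text \<open>Symmetry of \<open>B_tilde \<Sigma>\<close> merges the two cross terms, so the three
  blocks combine into one square of the total response.\<close>

lemma joint_form_hat_eq:
  assumes "positive_definite \<Sigma>"
  shows "joint_form_hat n \<Sigma> P v w =
     n * (\<Sum>s\<in>UNIV. P s * (joint_response s v w \<bullet> (B_tilde \<Sigma> *v joint_response s v w)))"
proof -
  note sym = B_tilde_inner_commute[OF assms]
  have "joint_response s v w \<bullet> (B_tilde \<Sigma> *v joint_response s v w) =
      (T_mat s *v (B_mat *v v)) \<bullet> (B_tilde \<Sigma> *v (T_mat s *v (B_mat *v v))) +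
      2 * ((T_mat s *v (B_mat *v v)) \<bullet> (B_tilde \<Sigma> *v (F_mat s *v (B_mat *v w)))) +
      (F_mat s *v (B_mat *v w)) \<bullet> (B_tilde \<Sigma> *v (F_mat s *v (B_mat *v w)))" for s
    unfolding joint_response_def matrix_vector_right_distrib inner_add_left inner_add_right
    by (simp add: sym[of "F_mat s *v (B_mat *v w)" "T_mat s *v (B_mat *v v)"])
  then show ?thesis
    by (simp add: joint_form_hat_def C_hat_inner distrib_left sum.distrib sum_distrib_left mult_ac)
qed

lemma joint_form_eq:
  assumes "positive_definite \<Sigma>"
  defines "m \<equiv> \<lambda>P v w. \<Sum>s\<in>UNIV. P s *\<^sub>R joint_response s v w"
  shows "joint_form n \<Sigma> P v w =
     joint_form_hat n \<Sigma> P v w - n * (m P v w \<bullet> (B_tilde \<Sigma> *v m P v w))"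
proof -
  note sym = B_tilde_inner_commute[OF assms(1)]
  have m: "m P v w = G_mean T_mat P *v v + G_mean F_mat P *v w"
    by (simp add: m_def joint_response_def G_mean_mult_vec scaleR_add_right sum.distrib)
  show ?thesis
    unfolding m matrix_vector_right_distrib inner_add_left inner_add_right
    by (simp add: joint_form_def joint_form_hat_def C_block_inner algebra_simps
        sym[of "G_mean F_mat P *v w" "G_mean T_mat P *v v"])
qed

lemma joint_form_le_hat:
  assumes "positive_definite \<Sigma>"
  shows "joint_form n \<Sigma> P v w \<le> joint_form_hat n \<Sigma> P v w"
  using nonneg_definite_B_tilde[OF assms]
  by (simp add: joint_form_eq[OF assms] nonneg_definite_def)

text \<open>Up to the factor \<open>n\<close>, the form is the variance of
  \<open>joint_response\<close> under the weights \<open>P\<close>, measured in the seminorm of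
  \<open>B_tilde \<Sigma>\<close>.\<close>

lemma joint_form_nonneg:
  fixes P :: "('p::{finite,linorder}, 't::finite) design"
  assumes "positive_definite \<Sigma>" and "approx_design P"
  shows "0 \<le> joint_form n \<Sigma> P v w"
proof -
  define y where "y s = joint_response s v w" for s :: "'p \<Rightarrow> 't"
  define m where "m = (\<Sum>s\<in>UNIV. P s *\<^sub>R y s)"
  define K where "K = B_tilde \<Sigma>"
  have P: "\<And>s. P s \<ge> 0" "(\<Sum>s\<in>UNIV. P s) = 1" using assms(2) by (auto simp: approx_design_def)
  have nn: "x \<bullet> (K *v x) \<ge> 0" for x
    using nonneg_definite_B_tilde[OF assms(1)] by (simp add: K_def nonneg_definite_def)
  note sym = B_tilde_inner_commute[OF assms(1), folded K_def]
  have my: "(\<Sum>s\<in>UNIV. P s * (m \<bullet> (K *v y s))) = m \<bullet> (K *v m)"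
    by (simp add: m_def linear_sum[OF matrix_vector_mul_linear, of K "\<lambda>s. P s *\<^sub>R y s"]
        matrix_vector_mult_scaleR inner_sum_right)
  have "0 \<le> (\<Sum>s\<in>UNIV. P s * ((y s - m) \<bullet> (K *v (y s - m))))"
    using P nn by (intro sum_nonneg mult_nonneg_nonneg)
  also have "\<dots> = (\<Sum>s\<in>UNIV. P s * (y s \<bullet> (K *v y s)) - 2 * (P s * (m \<bullet> (K *v y s)))
        + P s * (m \<bullet> (K *v m)))"
    by (intro sum.cong refl)
      (simp add: matrix_vector_mult_diff_distrib inner_diff_left inner_diff_right sym[of "y _" m] algebra_simps)
  also have "\<dots> = (\<Sum>s\<in>UNIV. P s * (y s \<bullet> (K *v y s))) - m \<bullet> (K *v m)"
    using P(2) by (simp add: sum.distrib sum_subtractf sum_distrib_left[symmetric]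
        sum_distrib_right[symmetric] my)
  finally show ?thesis
    unfolding joint_form_eq[OF assms(1)] joint_form_hat_eq[OF assms(1)] m_def y_def K_def
    by (simp add: right_diff_distrib[symmetric])
qed

section \<open>Both information matrices as partial minima\<close>

text \<open>Nonnegativity of \<open>h\<close> forces the kernel of \<open>D\<close> into that of
  \<open>C\<close>. Hence the stationarity equation \<open>D *v w = - (transpose C *v v)\<close> is
  solved through any generalized inverse, and \<open>h v z - h v w\<close> is the
  \<open>D\<close>-form at \<open>z - w\<close>.\<close>

lemma schur_complement_minimizer:
  fixes A C D G :: "real^'n^'n"
  defines "h \<equiv> \<lambda>v w. v \<bullet> (A *v v) + 2 * (v \<bullet> (C *v w)) + w \<bullet> (D *v w)"
  assumes h0: "\<And>v w. 0 \<le> h v w" and D: "transpose D = D" and G: "is_ginverse D G"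
  obtains w where "v \<bullet> ((A - C ** G ** transpose C) *v v) = h v w" and "\<And>z. h v w \<le> h v z"
proof -
  have Dnn: "0 \<le> z \<bullet> (D *v z)" for z using h0[of 0 z] by (simp add: h_def)
  have Dsym: "x \<bullet> (D *v y) = y \<bullet> (D *v x)" for x y
    by (metis D symmetric_inner_mult inner_commute)
  \<comment> \<open>On the kernel of \<open>D\<close> the quadratic term is absent:
    \<open>h (C *v u) (c *\<^sub>R u)\<close> is affine in \<open>c\<close>.\<close>
  have ker: "C *v u = 0" if u: "D *v u = 0" for u
  proof -
    have "(C *v u) \<bullet> (C *v u) = 0"
    proof (rule linear_coeff_eq_0_if_affine_nonneg)
      fix c :: real
      show "0 \<le> (C *v u) \<bullet> (A *v (C *v u)) + 2 * c * ((C *v u) \<bullet> (C *v u))"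
        using h0[of "C *v u" "c *\<^sub>R u"] by (simp add: h_def matrix_vector_mult_scaleR u)
    qed
    then show ?thesis by simp
  qed
  define w where "w = - (G *v (transpose C *v v))"
  have Dw: "D *v w = - (transpose C *v v)"
  proof -
    have DGD: "D *v (G *v (D *v z)) = D *v z" for z
      using G by (simp only: is_ginverse_def matrix_vector_mul_assoc matrix_mul_assoc)
    \<comment> \<open>\<open>G\<close> may fail to be symmetric, but its transpose is again a
      generalized inverse of the symmetric \<open>D\<close>.\<close>
    have DGD': "D *v (transpose G *v (D *v z)) = D *v z" for z
      using arg_cong[OF G[unfolded is_ginverse_def], of transpose]
      by (simp add: matrix_transpose_mul D matrix_vector_mul_assoc matrix_mul_assoc
          del: transpose_matrix_vector)
    have "z \<bullet> (D *v w) = z \<bullet> (- (transpose C *v v))" for z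
    proof -
      have "C *v (z - transpose G *v (D *v z)) = 0"
        by (rule ker) (simp only: matrix_vector_mult_diff_distrib DGD' diff_self)
      then have Cz: "C *v z = C *v (transpose G *v (D *v z))"
        by (simp only: matrix_vector_mult_diff_distrib right_minus_eq)
      have "z \<bullet> (D *v w) = - ((D *v z) \<bullet> (G *v (transpose C *v v)))"
        unfolding w_def using symmetric_inner_mult[OF D, of z]
        by (simp del: transpose_matrix_vector add: linear_neg[OF matrix_vector_mul_linear])
      also have "(D *v z) \<bullet> (G *v (transpose C *v v)) = (C *v (transpose G *v (D *v z))) \<bullet> v"
        by (metis inner_transpose_mult transpose_transpose)
      also have "\<dots> = z \<bullet> (transpose C *v v)" unfolding Cz[symmetric] inner_transpose_mult ..
      finally show ?thesis by simp
    qed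
    then show ?thesis by (metis vector_eq_ldot)
  qed
  have vCz: "v \<bullet> (C *v z) = - (z \<bullet> (D *v w))" for z
    unfolding Dw inner_minus_right inner_transpose_mult by (simp add: inner_commute)
  have "v \<bullet> ((A - C ** G ** transpose C) *v v) = v \<bullet> (A *v v) + v \<bullet> (C *v w)"
    unfolding w_def
    by (simp only: matrix_vector_mult_diff_rdistrib matrix_vector_mul_assoc[symmetric]
        inner_diff_right linear_neg[OF matrix_vector_mul_linear] inner_minus_right)
  also have "\<dots> = h v w" unfolding h_def using vCz[of w] by simp
  finally have "v \<bullet> ((A - C ** G ** transpose C) *v v) = h v w" .
  moreover have "h v w \<le> h v z" for z
  proof -
    have "0 \<le> (z - w) \<bullet> (D *v (z - w))" by (rule Dnn)
    also have "\<dots> = h v z - h v w"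
      unfolding h_def vCz
      by (simp add: matrix_vector_mult_diff_distrib inner_diff_left inner_diff_right Dsym[of w z])
    finally show ?thesis by simp
  qed
  ultimately show thesis by (rule that)
qed

lemma info_traditional_minimizer:
  assumes "positive_definite \<Sigma>" and "approx_design P"
  obtains w where "v \<bullet> (info_traditional n \<Sigma> P *v v) = joint_form n \<Sigma> P v w"
    and "\<And>z. joint_form n \<Sigma> P v w \<le> joint_form n \<Sigma> P v z"
proof -
  have "info_traditional n \<Sigma> P = C_block n \<Sigma> T_mat T_mat P -
     C_block n \<Sigma> T_mat F_mat P ** ginverse (C_block n \<Sigma> F_mat F_mat P) **
     transpose (C_block n \<Sigma> T_mat F_mat P)"
    by (simp add: info_traditional_def transpose_C_block[OF assms(1)])
  then show thesis
    using schur_complement_minimizer[of "C_block n \<Sigma> T_mat T_mat P" "C_block n \<Sigma> T_mat F_mat P"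
        "C_block n \<Sigma> F_mat F_mat P" "ginverse (C_block n \<Sigma> F_mat F_mat P)" v]
      joint_form_nonneg[OF assms] transpose_C_block[OF assms(1)] is_ginverse_ginverse that
    unfolding joint_form_def by (metis (no_types, lifting))
qed

text \<open>Both formulas are expressed by the same \<open>a\<close> and \<open>q\<close>, so that
  completing the square in \<open>c\<close> in the second one produces the subtracted term of the
  first at \<open>w = v\<close>.\<close>

lemma info_proportional_inner:
  fixes P :: "('p::{finite,linorder}, 't::finite) design" and \<tau> :: "real^'t" and n :: nat
    and lam :: real
  assumes "positive_definite \<Sigma>"
  defines "q \<equiv> \<tau> \<bullet> (C_block n \<Sigma> F_mat F_mat P *v \<tau>)"
    and "a \<equiv> (C_block n \<Sigma> T_mat F_mat P + lam *\<^sub>R C_block n \<Sigma> F_mat F_mat P) *v \<tau>"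
  shows "v \<bullet> (info_proportional n \<Sigma> lam \<tau> P *v w) =
      v \<bullet> (C_block n \<Sigma> T_mat T_mat P *v w) + lam * (v \<bullet> (C_block n \<Sigma> T_mat F_mat P *v w)) +
      lam * (v \<bullet> (C_block n \<Sigma> F_mat T_mat P *v w)) +
      lam\<^sup>2 * (v \<bullet> (C_block n \<Sigma> F_mat F_mat P *v w)) - (v \<bullet> a) * (w \<bullet> a) / q"
    and "joint_form n \<Sigma> P v (lam *\<^sub>R v + c *\<^sub>R \<tau>) =
      joint_form n \<Sigma> P v (lam *\<^sub>R v) + 2 * c * (v \<bullet> a) + c\<^sup>2 * q"
proof -
  have "\<tau> v* (C_block n \<Sigma> F_mat T_mat P + lam *\<^sub>R C_block n \<Sigma> F_mat F_mat P) =
      transpose (C_block n \<Sigma> F_mat T_mat P + lam *\<^sub>R C_block n \<Sigma> F_mat F_mat P) *v \<tau>"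
    by simp
  also have "\<dots> = a"
  proof -
    have "transpose (C_block n \<Sigma> F_mat T_mat P + lam *\<^sub>R C_block n \<Sigma> F_mat F_mat P) =
        transpose (C_block n \<Sigma> F_mat T_mat P) + lam *\<^sub>R transpose (C_block n \<Sigma> F_mat F_mat P)"
      by (simp add: transpose_def vec_eq_iff)
    then show ?thesis unfolding a_def transpose_C_block[OF assms(1)] by simp
  qed
  finally have a: "\<tau> v* (C_block n \<Sigma> F_mat T_mat P + lam *\<^sub>R C_block n \<Sigma> F_mat F_mat P) = a" .
  \<comment> \<open>For \<open>q = 0\<close> both sides are zero, since
    \<open>x / 0 = 0\<close>.\<close>
  have "(if q = 0 then 0 else (1 / q) *\<^sub>R outer a a) *v w = ((w \<bullet> a) / q) *\<^sub>R a"
    by (simp add: scaleR_matrix_vector_assoc[symmetric] outer_mult_vec inner_commute)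
  then show "v \<bullet> (info_proportional n \<Sigma> lam \<tau> P *v w) =
      v \<bullet> (C_block n \<Sigma> T_mat T_mat P *v w) + lam * (v \<bullet> (C_block n \<Sigma> T_mat F_mat P *v w)) +
      lam * (v \<bullet> (C_block n \<Sigma> F_mat T_mat P *v w)) +
      lam\<^sup>2 * (v \<bullet> (C_block n \<Sigma> F_mat F_mat P *v w)) - (v \<bullet> a) * (w \<bullet> a) / q"
    unfolding info_proportional_def Let_def a
    unfolding a_def[symmetric] q_def[symmetric]
    unfolding matrix_vector_mult_diff_rdistrib matrix_vector_mult_add_rdistrib
      scaleR_matrix_vector_assoc[symmetric]
    by (simp add: inner_diff_right inner_add_right algebra_simps)
  have sym: "\<tau> \<bullet> (C_block n \<Sigma> F_mat F_mat P *v v) = v \<bullet> (C_block n \<Sigma> F_mat F_mat P *v \<tau>)"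
    by (metis symmetric_inner_mult inner_commute transpose_C_block[OF assms(1)])
  show "joint_form n \<Sigma> P v (lam *\<^sub>R v + c *\<^sub>R \<tau>) =
      joint_form n \<Sigma> P v (lam *\<^sub>R v) + 2 * c * (v \<bullet> a) + c\<^sup>2 * q"
    unfolding joint_form_def a_def q_def matrix_vector_right_distrib matrix_vector_mult_scaleR
      inner_add_left inner_add_right inner_scaleR_left inner_scaleR_right sym
      matrix_vector_mult_add_rdistrib scaleR_matrix_vector_assoc[symmetric]
    by (simp add: power2_eq_square algebra_simps)
qed

text \<open>Completing the square in the coefficient of \<tau>. If \<open>q = 0\<close>, the form is
  affine in that coefficient and nonnegative, hence constant, and \<open>x / 0 = 0\<close> keeps all
  formulas valid with \<open>c = 0\<close>.\<close>

lemma info_proportional_minimizer: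
  fixes P :: "('p::{finite,linorder}, 't::finite) design"
  assumes "positive_definite \<Sigma>" and "approx_design P"
  obtains c where "v \<bullet> (info_proportional n \<Sigma> lam \<tau> P *v v) =
      joint_form n \<Sigma> P v (lam *\<^sub>R v + c *\<^sub>R \<tau>)"
    and "\<And>z. joint_form n \<Sigma> P v (lam *\<^sub>R v + c *\<^sub>R \<tau>) \<le> joint_form n \<Sigma> P v (lam *\<^sub>R v + z *\<^sub>R \<tau>)"
proof -
  define q where "q = \<tau> \<bullet> (C_block n \<Sigma> F_mat F_mat P *v \<tau>)"
  define a where "a = (C_block n \<Sigma> T_mat F_mat P + lam *\<^sub>R C_block n \<Sigma> F_mat F_mat P) *v \<tau>"
  define k where "k = joint_form n \<Sigma> P v (lam *\<^sub>R v)"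
  note eqs = info_proportional_inner[OF assms(1), where P = P and \<tau> = \<tau> and n = n and lam = lam,
      folded q_def a_def]
  have form: "joint_form n \<Sigma> P v (lam *\<^sub>R v + z *\<^sub>R \<tau>) = k + 2 * z * (v \<bullet> a) + z\<^sup>2 * q" for z
    unfolding eqs(2) k_def ..
  have "v \<bullet> (C_block n \<Sigma> F_mat T_mat P *v v) = v \<bullet> (C_block n \<Sigma> T_mat F_mat P *v v)"
    by (metis inner_transpose_mult inner_commute transpose_C_block[OF assms(1)])
  then have info: "v \<bullet> (info_proportional n \<Sigma> lam \<tau> P *v v) = k - (v \<bullet> a)\<^sup>2 / q"
    unfolding eqs(1) k_def joint_form_def
    by (simp add: matrix_vector_mult_scaleR power2_eq_square)
  have "q \<ge> 0" using joint_form_nonneg[OF assms, of n 0 \<tau>] by (simp add: q_def joint_form_def)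
  have "v \<bullet> a = 0" if "q = 0"
  proof (rule linear_coeff_eq_0_if_affine_nonneg)
    show "0 \<le> k + 2 * z * (v \<bullet> a)" for z
      using joint_form_nonneg[OF assms, of n v "lam *\<^sub>R v + z *\<^sub>R \<tau>"] that
      by (simp add: form)
  qed
  then have sq: "(z + (v \<bullet> a) / q)\<^sup>2 * q = 2 * z * (v \<bullet> a) + z\<^sup>2 * q + (v \<bullet> a)\<^sup>2 / q" for z
    by (cases "q = 0") (auto simp: field_simps power2_eq_square)
  define c where "c = - (v \<bullet> a) / q"
  have c: "joint_form n \<Sigma> P v (lam *\<^sub>R v + c *\<^sub>R \<tau>) = k - (v \<bullet> a)\<^sup>2 / q"
    using sq[of c] unfolding form by (simp add: c_def)
  show thesis
  proof (rule that[of c])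
    show "v \<bullet> (info_proportional n \<Sigma> lam \<tau> P *v v) = joint_form n \<Sigma> P v (lam *\<^sub>R v + c *\<^sub>R \<tau>)"
      unfolding c info ..
    show "joint_form n \<Sigma> P v (lam *\<^sub>R v + c *\<^sub>R \<tau>) \<le> joint_form n \<Sigma> P v (lam *\<^sub>R v + z *\<^sub>R \<tau>)" for z
    proof -
      have "0 \<le> (z + (v \<bullet> a) / q)\<^sup>2 * q" using \<open>q \<ge> 0\<close> by simp
      then show ?thesis unfolding c form[of z] sq by simp
    qed
  qed
qed

lemma nonneg_definite_info_proportional:
  fixes P :: "('p::{finite,linorder}, 't::finite) design"
  assumes "positive_definite \<Sigma>" and "approx_design P"
  shows "nonneg_definite (info_proportional n \<Sigma> lam \<tau> P)"
proof -
  let ?M = "info_proportional n \<Sigma> lam \<tau> P"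
  have tr: "v \<bullet> (C_block n \<Sigma> G H P *v w) = w \<bullet> (C_block n \<Sigma> H G P *v v)" for v w G H
    by (metis inner_transpose_mult inner_commute transpose_C_block[OF assms(1)])
  have "v \<bullet> (?M *v w) = v \<bullet> (transpose ?M *v w)" for v w
    unfolding inner_transpose_mult inner_commute[of "?M *v v"] info_proportional_inner[OF assms(1)]
    by (simp add: tr[of v _ _ w])
  then have "?M = transpose ?M" by (rule matrix_eqI_inner)
  moreover have "0 \<le> v \<bullet> (?M *v v)" for v
    using info_proportional_minimizer[OF assms, of v n lam \<tau>] joint_form_nonneg[OF assms] by metis
  ultimately show ?thesis by (simp add: nonneg_definite_def)
qed

lemma info_proportional_mult_one:
  fixes P :: "('p::{finite,linorder}, 't::finite) design"
  assumes "positive_definite \<Sigma>"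
  shows "info_proportional n \<Sigma> lam \<tau> P *v 1 = 0"
proof -
  have "1 \<bullet> (C_block n \<Sigma> T_mat F_mat P *v \<tau>) = 0" "1 \<bullet> (C_block n \<Sigma> F_mat F_mat P *v \<tau>) = 0"
    using C_block_mult_one transpose_C_block[OF assms] inner_transpose_mult
    by (metis inner_zero_left)+
  then have "v \<bullet> (info_proportional n \<Sigma> lam \<tau> P *v 1) = v \<bullet> 0" for v
    unfolding info_proportional_inner[OF assms]
    by (simp add: C_block_mult_one matrix_vector_mult_add_rdistrib inner_add_right
        scaleR_matrix_vector_assoc[symmetric])
  then show ?thesis by (metis vector_eq_ldot)
qed

lemma second_smallest_eigenvalue_info_proportional:
  fixes P :: "('p::{finite,linorder}, 't::finite) design"
  assumes "positive_definite \<Sigma>" and "approx_design P" and "CARD('t) \<ge> 2"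
  shows "second_smallest_eigenvalue (info_proportional n \<Sigma> lam \<tau> P) =
     min_contrast_info (info_proportional n \<Sigma> lam \<tau> P)"
  by (rule second_smallest_eigenvalue_eq_min_contrast_info[OF assms(3)
        nonneg_definite_info_proportional[OF assms(1,2)] info_proportional_mult_one[OF assms(1)]])

lemma min_contrast_info_traditional_le_proportional:
  fixes P :: "('p::{finite,linorder}, 't::finite) design"
  assumes "positive_definite \<Sigma>" and "approx_design P" and "CARD('t) \<ge> 2"
  shows "min_contrast_info (info_traditional n \<Sigma> P) \<le>
     min_contrast_info (info_proportional n \<Sigma> lam \<tau> P)"
proof (rule min_contrast_info_ge[OF assms(3)])
  fix v :: "real^'t" assume "v \<in> unit_contrasts"
  then have "min_contrast_info (info_traditional n \<Sigma> P) \<le> v \<bullet> (info_traditional n \<Sigma> P *v v)"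
    by (rule min_contrast_info_le)
  also have "\<dots> \<le> v \<bullet> (info_proportional n \<Sigma> lam \<tau> P *v v)"
    using info_traditional_minimizer[OF assms(1,2), of v n]
      info_proportional_minimizer[OF assms(1,2), of v n lam \<tau>] by metis
  finally show "min_contrast_info (info_traditional n \<Sigma> P)
      \<le> v \<bullet> (info_proportional n \<Sigma> lam \<tau> P *v v)" .
qed

section \<open>Symmetrized designs\<close>

lemma finite_bij: "finite {\<pi> :: 'a::finite \<Rightarrow> 'a. bij \<pi>}"
  by (rule finite_subset[OF subset_UNIV finite])

lemma card_bij_pos: "0 < card {\<pi> :: 'a::finite \<Rightarrow> 'a. bij \<pi>}"
  using finite_bij bij_id by (auto simp: card_gt_0_iff)

lemma real_card_bij_neq_0: "real (card {\<pi> :: 'a::finite \<Rightarrow> 'a. bij \<pi>}) \<noteq> 0"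
  by (metis card_bij_pos of_nat_0_eq_iff less_irrefl)

lemma sum_bij_comp:
  assumes "bij \<sigma>"
  shows "(\<Sum>\<pi> | bij \<pi>. f (\<pi> \<circ> \<sigma>)) = (\<Sum>\<pi> | bij (\<pi> :: 'a::finite \<Rightarrow> 'a). f \<pi>)"
proof (rule sum.reindex_bij_betw)
  have "\<sigma> \<circ> inv \<sigma> = id" "inv \<sigma> \<circ> \<sigma> = id"
    using bij_is_inj[OF assms] bij_is_surj[OF assms] by (simp_all only: inj_iff surj_iff)
  then show "bij_betw (\<lambda>\<pi>. \<pi> \<circ> \<sigma>) {\<pi>. bij \<pi>} {\<pi>. bij \<pi>}"
    using assms by (intro bij_betwI[where g = "\<lambda>\<pi>. \<pi> \<circ> inv \<sigma>"])
      (auto simp: bij_comp bij_imp_bij_inv comp_assoc)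
qed

lemma sum_bij_inv: "(\<Sum>\<pi> | bij \<pi>. f (inv \<pi>)) = (\<Sum>\<pi> | bij (\<pi> :: 'a::finite \<Rightarrow> 'a). f \<pi>)"
proof (rule sum.reindex_bij_betw)
  show "bij_betw inv {\<pi> :: 'a \<Rightarrow> 'a. bij \<pi>} {\<pi>. bij \<pi>}"
    by (intro bij_betwI[where g = inv]) (auto simp: bij_imp_bij_inv inv_inv_eq)
qed

lemma sum_comp_bij:
  assumes "bij (\<pi> :: 'b::finite \<Rightarrow> 'b)"
  shows "(\<Sum>s\<in>UNIV. f (\<pi> \<circ> s)) = (\<Sum>s\<in>UNIV. f (s :: 'a::finite \<Rightarrow> 'b))"
proof (rule sum.reindex_bij_betw)
  have "\<pi> \<circ> (inv \<pi> \<circ> s) = s" "inv \<pi> \<circ> (\<pi> \<circ> s) = s" for s :: "'a \<Rightarrow> 'b"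
    using surj_f_inv_f[OF bij_is_surj[OF assms]] inv_f_f[OF bij_is_inj[OF assms]]
    by (simp_all add: fun_eq_iff)
  then show "bij_betw (\<lambda>s :: 'a \<Rightarrow> 'b. \<pi> \<circ> s) UNIV UNIV"
    by (intro bij_betwI[where g = "\<lambda>s. inv \<pi> \<circ> s"]) auto
qed

text \<open>Composition with transpositions shows that all coordinates of the sum are equal, and
  they add up to zero because every permuted vector is a contrast.\<close>

lemma sum_permute_vec_contrast:
  fixes v :: "real^'n"
  assumes "1 \<bullet> v = 0"
  shows "(\<Sum>\<pi> | bij \<pi>. permute_vec \<pi> v) = 0"
proof -
  define c where "c i = (\<Sum>\<pi> | bij \<pi>. v $ \<pi> i)" for i :: 'n
  have const: "c i = c j" for i j
    using sum_bij_comp[of "Transposition.transpose i j" "\<lambda>\<pi>. v $ \<pi> i"] by (simp add: c_def)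
  have "(\<Sum>i\<in>UNIV. c i) = (\<Sum>\<pi> | bij (\<pi> :: 'n \<Rightarrow> 'n). \<Sum>i\<in>UNIV. v $ \<pi> i)"
    unfolding c_def by (rule sum.swap)
  also have "\<dots> = (\<Sum>\<pi> | bij (\<pi> :: 'n \<Rightarrow> 'n). 0)"
  proof (rule sum.cong)
    fix \<pi> :: "'n \<Rightarrow> 'n" assume "\<pi> \<in> {\<pi>. bij \<pi>}"
    then show "(\<Sum>i\<in>UNIV. v $ \<pi> i) = 0"
      using assms one_inner_permute_vec[of \<pi> v] by (simp add: one_inner_vec)
  qed simp
  finally have "(\<Sum>i\<in>UNIV. c i) = 0" by simp
  moreover have "(\<Sum>i\<in>UNIV. c i) = real CARD('n) * c j" for j
  proof -
    have "(\<Sum>i\<in>UNIV. c i) = (\<Sum>i\<in>(UNIV :: 'n set). c j)" by (intro sum.cong refl const)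
    then show ?thesis by simp
  qed
  ultimately have "c j = 0" for j by simp
  then show ?thesis by (simp add: vec_eq_iff c_def)
qed

text \<open>Permutations act transitively on the diagonal positions and on the off-diagonal ones, so
  \<open>A\<close> has one value on each. The vanishing row sums determine their ratio.\<close>

lemma permutation_invariant_matrix:
  fixes A :: "real^'n^'n"
  assumes inv: "\<And>\<sigma> v w. bij \<sigma> \<Longrightarrow> permute_vec \<sigma> v \<bullet> (A *v permute_vec \<sigma> w) = v \<bullet> (A *v w)"
    and ker: "A *v 1 = 0"
  obtains \<alpha> where "A = \<alpha> *\<^sub>R B_mat"
proof -
  have entry: "A $ i $ j = axis i 1 \<bullet> (A *v axis j 1)" for i j
    by (simp add: matrix_vector_mult_basis column_def inner_axis')
  have perm: "A $ \<sigma> i $ \<sigma> j = A $ i $ j" if "bij \<sigma>" for \<sigma> i j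
  proof -
    have "permute_vec \<sigma> (axis (\<sigma> k) 1) = axis k (1::real)" for k
      using bij_is_inj[OF that] by (auto simp: vec_eq_iff axis_def inj_eq)
    then show ?thesis unfolding entry using inv[OF that] by metis
  qed
  have diag: "A $ i $ i = A $ k $ k" for i k
    using perm[of "Transposition.transpose i k" i i] by simp
  have off: "A $ i $ j = A $ k $ l" if "i \<noteq> j" "k \<noteq> l" for i j k l
  proof -
    \<comment> \<open>First move \<open>i\<close> to \<open>k\<close>. The second transposition
      takes the image of \<open>j\<close> to \<open>l\<close> and fixes \<open>k\<close>, which
      differs from both.\<close>
    define \<rho> where "\<rho> = Transposition.transpose i k"
    define \<sigma> where "\<sigma> = Transposition.transpose (\<rho> j) l \<circ> \<rho>"
    have "\<rho> i = k" by (simp add: \<rho>_def)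
    moreover have "\<rho> j \<noteq> k"
      using that by (auto simp: \<rho>_def Transposition.transpose_def)
    ultimately have "\<sigma> i = k" "\<sigma> j = l"
      using that by (auto simp: \<sigma>_def Transposition.transpose_def)
    moreover have "bij \<sigma>" by (simp add: \<sigma>_def \<rho>_def bij_comp)
    ultimately show ?thesis using perm[of \<sigma> i j] by simp
  qed
  obtain e where e: "\<And>i j. i \<noteq> j \<Longrightarrow> A $ i $ j = e" using off by metis
  have row: "A $ i $ i = - (real CARD('n) - 1) * e" for i
  proof -
    have "0 = (\<Sum>j\<in>UNIV. A $ i $ j)"
      using arg_cong[OF ker, of "\<lambda>x. x $ i"] by (simp add: matrix_vector_mult_def)
    also have "\<dots> = A $ i $ i + (\<Sum>j\<in>UNIV - {i}. A $ i $ j)"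
      by (rule sum.remove) auto
    also have "(\<Sum>j\<in>UNIV - {i}. A $ i $ j) = (\<Sum>j\<in>UNIV - {i}. e)"
      by (intro sum.cong) (auto simp: e)
    also have "\<dots> = (real CARD('n) - 1) * e"
      by (simp add: card_Diff_singleton of_nat_diff Suc_leI)
    finally show ?thesis by (simp add: algebra_simps)
  qed
  have "A = (- real CARD('n) * e) *\<^sub>R B_mat"
    by (auto simp: vec_eq_iff B_mat_def J_mat_def mat_def row e field_simps)
  then show thesis by (rule that)
qed

section \<open>Relabelling the treatments of a sequence\<close>

lemma T_mat_mult_vec: "T_mat s *v x = (\<chi> k. x $ s k)"
  by (simp add: T_mat_def matrix_vector_mult_def vec_eq_iff if_distribR if_distrib cong: if_cong)

lemma F_mat_mult_vec:
  "F_mat s *v x = (\<chi> k. if {j. j < k} \<noteq> {} then x $ s (Max {j. j < k}) else 0)"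
  by (simp add: F_mat_def matrix_vector_mult_def vec_eq_iff if_distribR if_distrib cong: if_cong)

lemma T_mat_comp: "T_mat (\<sigma> \<circ> s) *v x = T_mat s *v permute_vec \<sigma> x"
  by (simp add: T_mat_mult_vec)

lemma F_mat_comp: "F_mat (\<sigma> \<circ> s) *v x = F_mat s *v permute_vec \<sigma> x"
  by (simp add: F_mat_mult_vec cong: if_cong)

lemma B_mat_permute_vec: "bij \<sigma> \<Longrightarrow> B_mat *v permute_vec \<sigma> v = permute_vec \<sigma> (B_mat *v v)"
  by (simp add: B_mat_mult_vec one_inner_permute_vec vec_eq_iff)

lemma joint_response_comp:
  "bij \<sigma> \<Longrightarrow> joint_response (\<sigma> \<circ> s) v w = joint_response s (permute_vec \<sigma> v) (permute_vec \<sigma> w)"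
  by (simp add: joint_response_def T_mat_comp F_mat_comp B_mat_permute_vec)

section \<open>Averaging a design over all relabellings\<close>

definition symmetrized :: "('p::finite, 't::finite) design \<Rightarrow> ('p, 't) design" where
  "symmetrized P s = (\<Sum>\<pi> | bij \<pi>. P (\<pi> \<circ> s)) / real (card {\<pi> :: 't \<Rightarrow> 't. bij \<pi>})"

lemma symmetrized_comp: "bij \<sigma> \<Longrightarrow> symmetrized P (\<sigma> \<circ> s) = symmetrized P s"
  using sum_bij_comp[of \<sigma> "\<lambda>\<pi>. P (\<pi> \<circ> s)"] by (simp add: symmetrized_def comp_assoc)

text \<open>Averaging is transferred from the design to the summand: reindex the sequences for each
  \<pi>, then replace \<pi> by its inverse.\<close>

lemma sum_symmetrized:
  fixes P :: "('p::finite, 't::finite) design"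
  shows "real (card {\<pi> :: 't \<Rightarrow> 't. bij \<pi>}) * (\<Sum>s\<in>UNIV. symmetrized P s * f s) =
     (\<Sum>\<pi> | bij \<pi>. \<Sum>s\<in>UNIV. P s * f (\<pi> \<circ> s))"
proof -
  have N: "real (card {\<pi> :: 't \<Rightarrow> 't. bij \<pi>}) * symmetrized P s = (\<Sum>\<pi> | bij \<pi>. P (\<pi> \<circ> s))" for s
    unfolding symmetrized_def by (rule nonzero_mult_div_cancel_left[OF real_card_bij_neq_0, folded times_divide_eq_right])
  have "real (card {\<pi> :: 't \<Rightarrow> 't. bij \<pi>}) * (\<Sum>s\<in>UNIV. symmetrized P s * f s) =
      (\<Sum>s\<in>UNIV. \<Sum>\<pi> | bij \<pi>. P (\<pi> \<circ> s) * f s)"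
    unfolding sum_distrib_left mult.assoc[symmetric] N sum_distrib_right ..
  also have "\<dots> = (\<Sum>\<pi> | bij \<pi>. \<Sum>s\<in>UNIV. P (\<pi> \<circ> s) * f s)" by (rule sum.swap)
  also have "\<dots> = (\<Sum>\<pi> | bij \<pi>. \<Sum>s\<in>UNIV. P s * f (inv \<pi> \<circ> s))"
  proof (rule sum.cong)
    fix \<pi> :: "'t \<Rightarrow> 't" assume "\<pi> \<in> {\<pi>. bij \<pi>}"
    then have "bij \<pi>" by simp
    then have "inv \<pi> \<circ> (\<pi> \<circ> s) = s" for s :: "'p \<Rightarrow> 't"
      by (simp add: comp_assoc[symmetric] bij_is_inj)
    then show "(\<Sum>s\<in>UNIV. P (\<pi> \<circ> s) * f s) = (\<Sum>s\<in>UNIV. P s * f (inv \<pi> \<circ> s))"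
      using sum_comp_bij[OF \<open>bij \<pi>\<close>, of "\<lambda>s. P s * f (inv \<pi> \<circ> s)"] by simp
  qed simp
  also have "\<dots> = (\<Sum>\<pi> | bij \<pi>. \<Sum>s\<in>UNIV. P s * f (\<pi> \<circ> s))"
    by (rule sum_bij_inv)
  finally show ?thesis .
qed

lemma approx_design_symmetrized:
  fixes P :: "('p::finite, 't::finite) design"
  assumes "approx_design P"
  shows "approx_design (symmetrized P)"
  unfolding approx_design_def
proof (intro conjI allI)
  show "0 \<le> symmetrized P s" for s
    using assms by (simp add: symmetrized_def approx_design_def sum_nonneg)
  have "real (card {\<pi> :: 't \<Rightarrow> 't. bij \<pi>}) * (\<Sum>s\<in>UNIV. symmetrized P s) =
      real (card {\<pi> :: 't \<Rightarrow> 't. bij \<pi>})"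
    using sum_symmetrized[of P "\<lambda>_. 1"] assms by (simp add: approx_design_def)
  then show "(\<Sum>s\<in>UNIV. symmetrized P s) = 1"
    by (simp only: mult_cancel_left2 real_card_bij_neq_0 simp_thms)
qed

text \<open>\<open>joint_form_hat\<close> is linear in the design, unlike \<open>joint_form\<close>,
  and relabelling a sequence amounts to permuting both effect vectors.\<close>

lemma joint_form_hat_symmetrized:
  fixes P :: "('p::{finite,linorder}, 't::finite) design"
  assumes "positive_definite \<Sigma>"
  shows "real (card {\<pi> :: 't \<Rightarrow> 't. bij \<pi>}) * joint_form_hat n \<Sigma> (symmetrized P) v w =
     (\<Sum>\<pi> | bij \<pi>. joint_form_hat n \<Sigma> P (permute_vec \<pi> v) (permute_vec \<pi> w))"
proof -
  define f where "f s v w = joint_response s v w \<bullet> (B_tilde \<Sigma> *v joint_response s v w)"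
    for s :: "'p \<Rightarrow> 't" and v w
  have "real (card {\<pi> :: 't \<Rightarrow> 't. bij \<pi>}) * joint_form_hat n \<Sigma> (symmetrized P) v w =
      n * (\<Sum>\<pi> | bij \<pi>. \<Sum>s\<in>UNIV. P s * f (\<pi> \<circ> s) v w)"
    unfolding joint_form_hat_eq[OF assms] f_def[symmetric] mult.left_commute[of _ "real n"]
      sum_symmetrized ..
  also have "\<dots> = (\<Sum>\<pi> | bij \<pi>. joint_form_hat n \<Sigma> P (permute_vec \<pi> v) (permute_vec \<pi> w))"
    unfolding joint_form_hat_eq[OF assms] f_def sum_distrib_left[of "real n"]
    by (intro sum.cong refl) (simp add: joint_response_comp)
  finally show ?thesis .
qed

text \<open>The mean response is unchanged when \<open>v\<close> and \<open>w\<close> are permuted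
  together, so it equals its average over permutations. That average is zero because the permuted
  copies of a contrast sum to zero.\<close>

lemma joint_form_symmetrized:
  fixes P :: "('p::{finite,linorder}, 't::finite) design"
  assumes "positive_definite \<Sigma>"
  shows "joint_form n \<Sigma> (symmetrized P) v w = joint_form_hat n \<Sigma> (symmetrized P) v w"
proof -
  let ?m = "\<lambda>v w. \<Sum>s\<in>UNIV. symmetrized P s *\<^sub>R joint_response s v w"
  have zero: "(\<Sum>\<sigma> | bij \<sigma>. joint_response s (permute_vec \<sigma> v) (permute_vec \<sigma> w)) = 0"
    for s :: "'p \<Rightarrow> 't"
  proof -
    have B0: "(\<Sum>\<sigma> | bij \<sigma>. B_mat *v permute_vec \<sigma> x) = 0" for x :: "real^'t"
      using sum_permute_vec_contrast[OF one_inner_B_mat[of x]]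
      by (simp add: B_mat_permute_vec cong: sum.cong_simp)
    show ?thesis
      unfolding joint_response_def sum.distrib
        linear_sum[OF matrix_vector_mul_linear[of "T_mat s"], symmetric]
        linear_sum[OF matrix_vector_mul_linear[of "F_mat s"], symmetric] B0
      by simp
  qed
  have inv: "?m (permute_vec \<sigma> v) (permute_vec \<sigma> w) = ?m v w" if "bij \<sigma>" for \<sigma>
    using sum_comp_bij[OF that, of "\<lambda>s. symmetrized P s *\<^sub>R joint_response s v w"] that
    by (simp add: joint_response_comp symmetrized_comp)
  have "real (card {\<pi> :: 't \<Rightarrow> 't. bij \<pi>}) *\<^sub>R ?m v w = (\<Sum>\<sigma> | bij (\<sigma> :: 't \<Rightarrow> 't). ?m v w)"
    by (simp only: sum_constant_scaleR)
  also have "\<dots> = (\<Sum>\<sigma> | bij \<sigma>. ?m (permute_vec \<sigma> v) (permute_vec \<sigma> w))"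
    by (intro sum.cong refl inv[symmetric]) simp
  also have "\<dots> = 0"
    by (subst sum.swap) (simp add: scaleR_right.sum[symmetric] zero)
  finally have "?m v w = 0" by (simp only: scaleR_eq_0_iff real_card_bij_neq_0 simp_thms)
  then show ?thesis unfolding joint_form_eq[OF assms] by simp
qed

text \<open>The assumptions state how \<open>T_mat\<close> and \<open>F_mat\<close> react to
  relabelling, so one argument covers all three blocks.\<close>

lemma C_hat_symmetrized:
  fixes P :: "('p::{finite,linorder}, 't::finite) design"
    and G H :: "('p \<Rightarrow> 't) \<Rightarrow> real^'t^('p::{finite,linorder})"
  assumes "\<And>\<sigma> s x. G (\<sigma> \<circ> s) *v x = G s *v permute_vec \<sigma> x"
    and "\<And>\<sigma> s x. H (\<sigma> \<circ> s) *v x = H s *v permute_vec \<sigma> x"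
  obtains \<alpha> where "C_hat n \<Sigma> G H (symmetrized P) = \<alpha> *\<^sub>R B_mat"
proof (rule permutation_invariant_matrix)
  fix \<sigma> :: "'t \<Rightarrow> 't" and v w :: "real^'t"
  assume \<sigma>: "bij \<sigma>"
  let ?f = "\<lambda>s. symmetrized P s * ((G s *v (B_mat *v v)) \<bullet> (B_tilde \<Sigma> *v (H s *v (B_mat *v w))))"
  have "?f (\<sigma> \<circ> s) = symmetrized P s * ((G s *v (B_mat *v permute_vec \<sigma> v)) \<bullet>
      (B_tilde \<Sigma> *v (H s *v (B_mat *v permute_vec \<sigma> w))))" for s
    using \<sigma> by (simp add: assms symmetrized_comp B_mat_permute_vec)
  then show "permute_vec \<sigma> v \<bullet> (C_hat n \<Sigma> G H (symmetrized P) *v permute_vec \<sigma> w) =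
      v \<bullet> (C_hat n \<Sigma> G H (symmetrized P) *v w)"
    unfolding C_hat_inner using sum_comp_bij[OF \<sigma>, of ?f] by simp
next
  have "v \<bullet> (C_hat n \<Sigma> G H (symmetrized P) *v 1) = v \<bullet> 0" for v
    by (simp add: C_hat_inner B_mat_mult_one)
  then show "C_hat n \<Sigma> G H (symmetrized P) *v 1 = 0" by (metis vector_eq_ldot)
qed (rule that)

text \<open>\<open>B_mat\<close> is the orthogonal projection onto the contrasts.\<close>

lemma inner_B_mat: "v \<bullet> (B_mat *v w) = (B_mat *v v) \<bullet> (B_mat *v w)"
  using one_inner_B_mat[of w] by (simp add: B_mat_mult_vec[of v] inner_diff_left)

lemma joint_form_symmetrized_quadratic:
  fixes P :: "('p::{finite,linorder}, 't::finite) design"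
  assumes "positive_definite \<Sigma>" and "approx_design P" and "CARD('t) \<ge> 2"
  obtains a b c where "c \<ge> 0" and
    "\<And>v w. joint_form_hat n \<Sigma> (symmetrized P) v w =
       a * (v \<bullet> (B_mat *v v)) + 2 * b * (v \<bullet> (B_mat *v w)) + c * (w \<bullet> (B_mat *v w))"
proof -
  obtain a b c where C: "C_hat n \<Sigma> T_mat T_mat (symmetrized P) = a *\<^sub>R B_mat"
    "C_hat n \<Sigma> T_mat F_mat (symmetrized P) = b *\<^sub>R B_mat"
    "C_hat n \<Sigma> F_mat F_mat (symmetrized P) = c *\<^sub>R B_mat"
    using C_hat_symmetrized[of T_mat T_mat n \<Sigma> P, OF T_mat_comp T_mat_comp]
      C_hat_symmetrized[of T_mat F_mat n \<Sigma> P, OF T_mat_comp F_mat_comp]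
      C_hat_symmetrized[of F_mat F_mat n \<Sigma> P, OF F_mat_comp F_mat_comp] by metis
  have form: "joint_form_hat n \<Sigma> (symmetrized P) v w =
       a * (v \<bullet> (B_mat *v v)) + 2 * b * (v \<bullet> (B_mat *v w)) + c * (w \<bullet> (B_mat *v w))" for v w
    by (simp add: joint_form_hat_def C scaleR_matrix_vector_assoc[symmetric])
  \<comment> \<open>At \<open>v = 0\<close> and \<open>w = u\<close> the form reduces to
    \<open>c\<close>, which is therefore nonnegative.\<close>
  obtain u :: "real^'t" where "u \<in> unit_contrasts"
    using unit_contrasts_nonempty[OF assms(3)] by blast
  then have "u \<bullet> (B_mat *v u) = 1"
    by (simp add: unit_contrasts_def B_mat_mult_contrast norm_eq_1)
  moreover have "0 \<le> joint_form_hat n \<Sigma> (symmetrized P) 0 u"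
    using joint_form_nonneg[OF assms(1) approx_design_symmetrized[OF assms(2)], of n 0 u]
    by (simp add: joint_form_symmetrized[OF assms(1)])
  ultimately have "c \<ge> 0" unfolding form by simp
  then show thesis using form by (rule that)
qed

section \<open>Exchangeable priors\<close>

text \<open>For a symmetrized design the minimizing \<open>w\<close> may be taken parallel to
  \<open>v\<close>: replacing \<open>w\<close> by its component \<open>x *\<^sub>R v\<close> keeps
  the cross term and, by Cauchy-Schwarz, does not increase the last term.\<close>

lemma min_contrast_info_symmetrized_ge:
  fixes P :: "('p::{finite,linorder}, 't::finite) design"
  assumes "positive_definite \<Sigma>" and "approx_design P" and "CARD('t) \<ge> 2"
    and m: "\<And>v x. v \<in> unit_contrasts \<Longrightarrow> m \<le> joint_form_hat n \<Sigma> (symmetrized P) v (x *\<^sub>R v)"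
  shows "m \<le> min_contrast_info (info_traditional n \<Sigma> (symmetrized P))"
proof (rule min_contrast_info_ge[OF assms(3)])
  fix v :: "real^'t" assume v: "v \<in> unit_contrasts"
  obtain a b c where "c \<ge> 0" and form:
    "\<And>v w. joint_form_hat n \<Sigma> (symmetrized P) v w =
       a * (v \<bullet> (B_mat *v v)) + 2 * b * (v \<bullet> (B_mat *v w)) + c * (w \<bullet> (B_mat *v w))"
    using joint_form_symmetrized_quadratic[OF assms(1-3)] by metis
  obtain w where w: "v \<bullet> (info_traditional n \<Sigma> (symmetrized P) *v v) =
      joint_form n \<Sigma> (symmetrized P) v w"
    using info_traditional_minimizer[OF assms(1) approx_design_symmetrized[OF assms(2)]] by metis
  define x where "x = v \<bullet> (B_mat *v w)"
  have vv: "v \<bullet> v = 1" "B_mat *v v = v"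
    using v by (auto simp: unit_contrasts_def norm_eq_1 B_mat_mult_contrast)
  have "x\<^sup>2 \<le> (v \<bullet> v) * ((B_mat *v w) \<bullet> (B_mat *v w))"
    unfolding x_def by (rule Cauchy_Schwarz_ineq)
  then have "c * x\<^sup>2 \<le> c * (w \<bullet> (B_mat *v w))"
    using \<open>c \<ge> 0\<close> by (intro mult_left_mono) (simp_all add: vv inner_B_mat[of w])
  then have "joint_form_hat n \<Sigma> (symmetrized P) v (x *\<^sub>R v) \<le> joint_form n \<Sigma> (symmetrized P) v w"
    unfolding joint_form_symmetrized[OF assms(1)] form x_def[symmetric]
    by (simp add: matrix_vector_mult_scaleR vv power2_eq_square)
  then show "m \<le> v \<bullet> (info_traditional n \<Sigma> (symmetrized P) *v v)"
    using m[OF v, of x] unfolding w by simp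
qed

text \<open>The integrand is a continuous function of a matrix whose entries are rational in \<tau>,
  hence measurable. It lies between 0 and the value of the form at one fixed unit contrast with
  coefficient 0 of \<tau>, a bound free of \<tau>.\<close>

lemma integrable_min_contrast_info_proportional:
  fixes P :: "('p::{finite,linorder}, 't::finite) design"
  assumes "positive_definite \<Sigma>" and "approx_design P" and "CARD('t) \<ge> 2" and "is_prior g"
  shows "integrable g (\<lambda>\<tau>. min_contrast_info (info_proportional n \<Sigma> lam \<tau> P))"
proof -
  interpret prob_space g using assms(4) by (simp add: is_prior_def)
  have sets: "sets g = sets borel" using assms(4) by (simp add: is_prior_def)
  have cont: "continuous_on UNIV (\<lambda>\<tau>. A *v \<tau>)" for A :: "real^'t^'t"
    by (rule linear_continuous_on[OF matrix_vector_mul_bounded_linear])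
  define K where "K = C_block n \<Sigma> T_mat T_mat P + lam *\<^sub>R
    (C_block n \<Sigma> T_mat F_mat P + C_block n \<Sigma> F_mat T_mat P) + lam\<^sup>2 *\<^sub>R C_block n \<Sigma> F_mat F_mat P"
  define q where "q \<tau> = \<tau> \<bullet> (C_block n \<Sigma> F_mat F_mat P *v \<tau>)" for \<tau>
  define X where "X \<tau> = outer ((C_block n \<Sigma> T_mat F_mat P + lam *\<^sub>R C_block n \<Sigma> F_mat F_mat P) *v \<tau>)
    (transpose (C_block n \<Sigma> F_mat T_mat P + lam *\<^sub>R C_block n \<Sigma> F_mat F_mat P) *v \<tau>)" for \<tau>
  \<comment> \<open>The case distinction on \<open>q \<tau> = 0\<close> is absorbed by
    \<open>1 / 0 = 0\<close>.\<close>
  have info: "info_proportional n \<Sigma> lam \<tau> P = K - (1 / q \<tau>) *\<^sub>R X \<tau>" for \<tau>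
    unfolding info_proportional_def K_def q_def X_def Let_def by simp
  have "continuous_on UNIV q"
    unfolding q_def by (intro continuous_on_inner continuous_on_id cont)
  then have q: "q \<in> borel_measurable borel" by (rule borel_measurable_continuous_onI)
  have "continuous_on UNIV X"
    unfolding X_def outer_def
    by (intro continuous_on_vec_lambda continuous_on_mult continuous_on_component cont)
  then have X: "X \<in> borel_measurable borel" by (rule borel_measurable_continuous_onI)
  have "(\<lambda>\<tau>. info_proportional n \<Sigma> lam \<tau> P) \<in> borel_measurable borel"
    unfolding info using q X by measurable
  then have "(\<lambda>\<tau>. min_contrast_info (info_proportional n \<Sigma> lam \<tau> P)) \<in> borel_measurable borel"
    by (rule measurable_compose)
      (rule borel_measurable_continuous_onI[OF continuous_on_min_contrast_info[OF assms(3)]])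
  then have meas: "(\<lambda>\<tau>. min_contrast_info (info_proportional n \<Sigma> lam \<tau> P)) \<in> borel_measurable g"
    by (simp add: measurable_cong_sets[OF sets refl])
  obtain u :: "real^'t" where u: "u \<in> unit_contrasts"
    using unit_contrasts_nonempty[OF assms(3)] by blast
  have "norm (min_contrast_info (info_proportional n \<Sigma> lam \<tau> P)) \<le> joint_form n \<Sigma> P u (lam *\<^sub>R u)" for \<tau>
  proof -
    have "0 \<le> min_contrast_info (info_proportional n \<Sigma> lam \<tau> P)"
      using nonneg_definite_info_proportional[OF assms(1,2), of n lam \<tau>]
      by (intro min_contrast_info_ge[OF assms(3)]) (simp add: nonneg_definite_def)
    moreover obtain c where
      "u \<bullet> (info_proportional n \<Sigma> lam \<tau> P *v u) = joint_form n \<Sigma> P u (lam *\<^sub>R u + c *\<^sub>R \<tau>)"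
      "joint_form n \<Sigma> P u (lam *\<^sub>R u + c *\<^sub>R \<tau>) \<le> joint_form n \<Sigma> P u (lam *\<^sub>R u + 0 *\<^sub>R \<tau>)"
      using info_proportional_minimizer[OF assms(1,2), of u n lam \<tau>] by metis
    ultimately show ?thesis
      using min_contrast_info_le[OF u, of "info_proportional n \<Sigma> lam \<tau> P"] by simp
  qed
  then show ?thesis by (intro integrable_const_bound[OF _ meas]) auto
qed

text \<open>
  By exchangeability the ratio for \<open>P\<close> has the same mean as its average over permuted treatment
  labels, and that average is the ratio for the symmetrized design.
\<close>

lemma E_value_le_joint_form_hat:
  fixes P :: "('p::{finite,linorder}, 't::finite) design"
  assumes pd: "positive_definite \<Sigma>" and P: "approx_design P" and two: "CARD('t) \<ge> 2"
    and prior: "is_prior g" and exch: "exchangeable g" and u: "u \<in> unit_contrasts"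
  shows "E_value n \<Sigma> g lam P \<le> joint_form_hat n \<Sigma> (symmetrized P) u (x *\<^sub>R u)"
proof -
  interpret prob_space g using prior by (simp add: is_prior_def)
  have sets: "sets g = sets borel" using prior by (simp add: is_prior_def)
  \<comment> \<open>The upper bound for the eigenvalue obtained by testing with \<tau> itself. By
    the convention for division it is 0 at \<tau> = 0, so it is bounded everywhere.\<close>
  define f where "f \<tau> = joint_form_hat n \<Sigma> P \<tau> (x *\<^sub>R \<tau>) / (\<tau> \<bullet> \<tau>)" for \<tau>
  define A where "A = C_hat n \<Sigma> T_mat T_mat P + (2 * x) *\<^sub>R C_hat n \<Sigma> T_mat F_mat P +
    x\<^sup>2 *\<^sub>R C_hat n \<Sigma> F_mat F_mat P"
  let ?N = "real (card {\<pi> :: 't \<Rightarrow> 't. bij \<pi>})"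
  let ?\<beta> = "joint_form_hat n \<Sigma> (symmetrized P) u (x *\<^sub>R u)"
  have fA: "f \<tau> = (\<tau> \<bullet> (A *v \<tau>)) / (\<tau> \<bullet> \<tau>)" for \<tau>
    by (simp add: f_def A_def joint_form_hat_def matrix_vector_mult_add_rdistrib inner_add_right
        scaleR_matrix_vector_assoc[symmetric] matrix_vector_mult_scaleR power2_eq_square)
  have "continuous_on UNIV (\<lambda>\<tau>. \<tau> \<bullet> (A *v \<tau>))" "continuous_on UNIV (\<lambda>\<tau> :: real^'t. \<tau> \<bullet> \<tau>)"
    by (intro continuous_on_inner continuous_on_id
        linear_continuous_on[OF matrix_vector_mul_bounded_linear])+
  then have f_meas: "f \<in> borel_measurable borel"
    unfolding fA[abs_def] by (intro borel_measurable_divide borel_measurable_continuous_onI)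
  have f_bound: "norm (f \<tau>) \<le> onorm ((*v) A)" for \<tau>
  proof (cases "\<tau> = 0")
    case False
    have "\<bar>\<tau> \<bullet> (A *v \<tau>)\<bar> \<le> norm \<tau> * norm (A *v \<tau>)" by (rule Cauchy_Schwarz_ineq2)
    also have "\<dots> \<le> norm \<tau> * (onorm ((*v) A) * norm \<tau>)"
      by (intro mult_left_mono onorm matrix_vector_mul_bounded_linear norm_ge_zero)
    finally show ?thesis
      using False by (simp add: fA field_simps power2_norm_eq_inner[symmetric] power2_eq_square)
  qed (simp add: fA onorm_pos_le[OF matrix_vector_mul_bounded_linear])
  have perm_meas: "permute_vec \<pi> \<in> borel_measurable borel" for \<pi> :: "'t \<Rightarrow> 't"
    unfolding permute_vec_def
    by (intro borel_measurable_continuous_onI continuous_on_vec_lambda continuous_on_component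
        continuous_on_id)
  have f_int: "integrable g (\<lambda>\<tau>. f (permute_vec \<pi> \<tau>))" for \<pi>
    using measurable_compose[OF perm_meas f_meas] f_bound
    by (intro integrable_const_bound[where B = "onorm ((*v) A)"])
      (auto simp: measurable_cong_sets[OF sets refl])
  have f_exch: "(\<integral>\<tau>. f (permute_vec \<pi> \<tau>) \<partial>g) = (\<integral>\<tau>. f \<tau> \<partial>g)" if "bij \<pi>" for \<pi>
  proof -
    have "distr g borel (permute_vec \<pi>) = g"
      using exch that unfolding exchangeable_def permute_vec_def[abs_def] by blast
    moreover have "(\<integral>\<tau>. f \<tau> \<partial>distr g borel (permute_vec \<pi>)) = (\<integral>\<tau>. f (permute_vec \<pi> \<tau>) \<partial>g)"
      using perm_meas f_meas by (intro integral_distr) (auto simp: measurable_cong_sets[OF sets refl])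
    ultimately show ?thesis by simp
  qed
  have contrast: "AE \<tau> in g. 1 \<bullet> \<tau> = 0 \<and> \<tau> \<noteq> 0"
    using prior by (simp add: is_prior_def one_inner_vec)
  obtain a b c where form:
    "\<And>v w. joint_form_hat n \<Sigma> (symmetrized P) v w =
       a * (v \<bullet> (B_mat *v v)) + 2 * b * (v \<bullet> (B_mat *v w)) + c * (w \<bullet> (B_mat *v w))"
    using joint_form_symmetrized_quadratic[OF pd P two] by metis
  have "?N * (\<integral>\<tau>. f \<tau> \<partial>g) = (\<Sum>\<pi> | bij (\<pi> :: 't \<Rightarrow> 't). \<integral>\<tau>. f (permute_vec \<pi> \<tau>) \<partial>g)"
    by (simp add: f_exch)
  also have "\<dots> = (\<integral>\<tau>. (\<Sum>\<pi> | bij \<pi>. f (permute_vec \<pi> \<tau>)) \<partial>g)"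
    by (rule Bochner_Integration.integral_sum[symmetric]) (rule f_int)
  also have "\<dots> = (\<integral>\<tau>. ?N * ?\<beta> \<partial>g)"
  proof (rule integral_cong_AE)
    show "AE \<tau> in g. (\<Sum>\<pi> | bij \<pi>. f (permute_vec \<pi> \<tau>)) = ?N * ?\<beta>"
      using contrast
    proof eventually_elim
      case (elim \<tau>)
      have "(\<Sum>\<pi> | bij \<pi>. f (permute_vec \<pi> \<tau>)) =
          (\<Sum>\<pi> | bij \<pi>. joint_form_hat n \<Sigma> P (permute_vec \<pi> \<tau>) (permute_vec \<pi> (x *\<^sub>R \<tau>))) / (\<tau> \<bullet> \<tau>)"
        unfolding f_def sum_divide_distrib
        by (intro sum.cong refl) (simp add: inner_permute_vec permute_vec_scaleR)
      also have "\<dots> = ?N * (joint_form_hat n \<Sigma> (symmetrized P) \<tau> (x *\<^sub>R \<tau>) / (\<tau> \<bullet> \<tau>))"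
        unfolding joint_form_hat_symmetrized[OF pd, symmetric] by simp
      \<comment> \<open>On nonzero contrasts the symmetrized ratio is
        \<open>a + 2 * b * x + c * x\<^sup>2\<close>, independent of \<tau>, and a unit contrast
        gives the same number.\<close>
      also have "joint_form_hat n \<Sigma> (symmetrized P) \<tau> (x *\<^sub>R \<tau>) / (\<tau> \<bullet> \<tau>) = ?\<beta>"
        unfolding form using elim u
        by (simp add: B_mat_mult_contrast unit_contrasts_def norm_eq_1 field_simps)
      finally show ?case .
    qed
  qed (use f_int in \<open>auto intro!: borel_measurable_sum\<close>)
  also have "\<dots> = ?N * ?\<beta>" by (simp add: prob_space)
  finally have mean: "(\<integral>\<tau>. f \<tau> \<partial>g) = ?\<beta>"
    by (simp only: mult_left_cancel[OF real_card_bij_neq_0])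
  have "E_value n \<Sigma> g lam P = (\<integral>\<tau>. min_contrast_info (info_proportional n \<Sigma> lam \<tau> P) \<partial>g)"
    unfolding E_value_def second_smallest_eigenvalue_info_proportional[OF pd P two] ..
  also have "\<dots> \<le> (\<integral>\<tau>. f \<tau> \<partial>g)"
  proof (rule integral_mono_AE)
    show "integrable g (\<lambda>\<tau>. min_contrast_info (info_proportional n \<Sigma> lam \<tau> P))"
      by (rule integrable_min_contrast_info_proportional[OF pd P two prior])
    have "permute_vec id = (\<lambda>v :: real^'t. v)" by (simp add: fun_eq_iff vec_eq_iff)
    then show "integrable g f" using f_int[of id] by simp
    show "AE \<tau> in g. min_contrast_info (info_proportional n \<Sigma> lam \<tau> P) \<le> f \<tau>"
      using contrast
    proof eventually_elim
      case (elim \<tau>)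
      have "min_contrast_info (info_proportional n \<Sigma> lam \<tau> P) * (\<tau> \<bullet> \<tau>)
          \<le> \<tau> \<bullet> (info_proportional n \<Sigma> lam \<tau> P *v \<tau>)"
        using elim by (intro min_contrast_info_mult_le) simp
      \<comment> \<open>When \<open>v\<close> is \<tau>, the line through
        \<open>lam *\<^sub>R v\<close> in direction \<tau> contains every multiple of \<tau>; the
        coefficient \<open>x - lam\<close> reaches \<open>x *\<^sub>R \<tau>\<close>.\<close>
      also have "\<dots> \<le> joint_form n \<Sigma> P \<tau> (lam *\<^sub>R \<tau> + (x - lam) *\<^sub>R \<tau>)"
        using info_proportional_minimizer[OF pd P, of \<tau> n lam \<tau>] by metis
      also have "lam *\<^sub>R \<tau> + (x - lam) *\<^sub>R \<tau> = x *\<^sub>R \<tau>" by (simp add: scaleR_add_left[symmetric])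
      also have "joint_form n \<Sigma> P \<tau> (x *\<^sub>R \<tau>) \<le> joint_form_hat n \<Sigma> P \<tau> (x *\<^sub>R \<tau>)"
        by (rule joint_form_le_hat[OF pd])
      finally show ?case using elim by (simp add: f_def pos_le_divide_eq)
    qed
  qed
  finally show ?thesis unfolding mean .
qed

theorem corollary2:
  fixes n :: nat
    and \<Sigma> :: "real^('p::{finite,linorder})^('p::{finite,linorder})"
    and g :: "(real^('t::finite)) measure"
    and lam0 :: real
    and d :: "('p, 't) design"
  assumes "CARD('p) \<ge> 2"
    and "CARD('t) \<ge> 2"
    and "n \<ge> 1"
    and "positive_definite \<Sigma>"
    and "is_prior g"
    and "exchangeable g"
    and "universally_optimal n \<Sigma> d"
  shows "E_optimal n \<Sigma> g lam0 d"
proof -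
  interpret prob_space g using assms(5) by (simp add: is_prior_def)
  note two = assms(2) and pd = assms(4)
  have d: "approx_design d" using assms(7) by (simp add: universally_optimal_def)
  have "E_value n \<Sigma> g lam0 Q \<le> E_value n \<Sigma> g lam0 d" if Q: "approx_design Q" for Q
  proof -
    \<comment> \<open>The E-value of \<open>Q\<close> itself serves as the lower bound
      \<open>m\<close>; it lies below the symmetrized form for every unit contrast and every
      \<open>x\<close>.\<close>
    have "E_value n \<Sigma> g lam0 Q \<le> min_contrast_info (info_traditional n \<Sigma> (symmetrized Q))"
      by (intro min_contrast_info_symmetrized_ge[OF pd Q two]
          E_value_le_joint_form_hat[OF pd Q two assms(5,6)])
    \<comment> \<open>Universal optimality is applied against the symmetrized competitor instead of
      \<open>Q\<close>.\<close>
    also have "\<dots> \<le> min_contrast_info (info_traditional n \<Sigma> d)"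
      using assms(7) optimality_criterion_min_contrast_info[OF two] approx_design_symmetrized[OF Q]
      by (simp add: universally_optimal_def)
    \<comment> \<open>The bound holds for each \<tau>, and a constant is its own mean under a
      probability measure.\<close>
    also have "\<dots> \<le> (\<integral>\<tau>. min_contrast_info (info_proportional n \<Sigma> lam0 \<tau> d) \<partial>g)"
      by (intro integral_ge_const integrable_min_contrast_info_proportional[OF pd d two assms(5)] AE_I2
          min_contrast_info_traditional_le_proportional[OF pd d two])
    also have "\<dots> = E_value n \<Sigma> g lam0 d"
      unfolding E_value_def second_smallest_eigenvalue_info_proportional[OF pd d two] ..
    finally show ?thesis .
  qed
  then show ?thesis using d by (simp add: E_optimal_def)
qed

end
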